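(* Consider a sequence of instances of bipartite degree sequences $(s_i)_{i=1}^{n'}$, $(t_j)_{j=1}^{n''}$ (nonnegative integers) with $N=\sum_i s_i=\sum_j t_j$, and assume $N\to\infty$ and $s=o(N)$, $t=o(N)$, where $s=\max_i s_i$ and $t=\max_j t_j$. Then $$\mathbb{P}(G^*\text{ is simple})=\mathbb{P}(Z=0)=\mathbb{P}(\hat Z=0)+o(1)=\exp\Bigl(-\sum_{i,j}\bigl(\lambda_{ij}-\log(1+\lambda_{ij})\bigr)\Bigr)+o(1).$$
   Context: Bipartite configuration model: the two parts have vertices $v_1,\dots,v_{n'}$ and $w_1,\dots,w_{n''}$; attach $s_i$ half-edges to $v_i$ and $t_j$ half-edges to $w_j$, and join the $N$ half-edges of the first part to the $N$ half-edges of the second part by a uniformly random bijection, each matched pair forming an edge. This gives a random bipartite multigraph $G^*$ with $N$ edges. Let $X_{ij}$ be the number of edges between $v_i$ and $w_j$, $Y_{ij}=\binom{X_{ij}}2$, and $Z=\sum_{i=1}^{n'}\sum_{j=1}^{n''}Y_{ij}$. Let $\lambda_{ij}=\frac{\sqrt{s_i(s_i-1)t_j(t_j-1)}}{N}$, let $\hat X_{ij}\sim\mathrm{Po}(\lambda_{ij})$ be independent, and $\hat Z=\sum_{i,j}\binom{\hat X_{ij}}2$. *)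

theory Defs
  imports "HOL-Probability.Probability" "HOL-Library.Landau_Symbols"
begin

text \<open>
  A multigraph is represented by its multiset of edges, an edge being the set of its end points
  (a loop is a singleton).
\<close>

definition simple_multigraph :: "'v set multiset \<Rightarrow> bool" where
  "simple_multigraph G \<longleftrightarrow> (\<forall>e. e \<in># G \<longrightarrow> card e = 2 \<and> count G e = 1)"

text \<open>The pair \<open>(i, a)\<close> is the \<open>a\<close>-th of the \<open>d i\<close> half-edges at the \<open>i\<close>-th vertex of a part.\<close>

definition half_edges :: "nat \<Rightarrow> (nat \<Rightarrow> nat) \<Rightarrow> (nat \<times> nat) set" where
  "half_edges n d = (SIGMA i:{1..n}. {1..d i})"

definition matchings ::
  "nat \<Rightarrow> nat \<Rightarrow> (nat \<Rightarrow> nat) \<Rightarrow> (nat \<Rightarrow> nat) \<Rightarrow> (nat \<times> nat \<Rightarrow> nat \<times> nat) set" where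
  "matchings n' n'' s t =
     {f \<in> half_edges n' s \<rightarrow>\<^sub>E half_edges n'' t. bij_betw f (half_edges n' s) (half_edges n'' t)}"

text \<open>The vertex \<open>v\<^sub>i\<close> of the first part is \<open>Inl i\<close>, the vertex \<open>w\<^sub>j\<close> of the second part is \<open>Inr j\<close>.\<close>

definition matching_graph ::
  "nat \<Rightarrow> (nat \<Rightarrow> nat) \<Rightarrow> (nat \<times> nat \<Rightarrow> nat \<times> nat) \<Rightarrow> (nat + nat) set multiset" where
  "matching_graph n' s f =
     image_mset (\<lambda>h. {Inl (fst h), Inr (fst (f h))}) (mset_set (half_edges n' s))"

definition bip_config_model ::
  "nat \<Rightarrow> nat \<Rightarrow> (nat \<Rightarrow> nat) \<Rightarrow> (nat \<Rightarrow> nat) \<Rightarrow> (nat + nat) set multiset pmf" where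
  "bip_config_model n' n'' s t = map_pmf (matching_graph n' s) (pmf_of_set (matchings n' n'' s t))"

definition edge_mult :: "(nat + nat) set multiset \<Rightarrow> nat \<Rightarrow> nat \<Rightarrow> nat" where
  "edge_mult G i j = count G {Inl i, Inr j}"

definition pair_count :: "nat \<Rightarrow> nat \<Rightarrow> (nat \<Rightarrow> nat \<Rightarrow> nat) \<Rightarrow> nat" where
  "pair_count n' n'' x = (\<Sum>i=1..n'. \<Sum>j=1..n''. x i j choose 2)"

definition bip_lambda :: "nat \<Rightarrow> (nat \<Rightarrow> nat) \<Rightarrow> (nat \<Rightarrow> nat) \<Rightarrow> nat \<Rightarrow> nat \<Rightarrow> real" where
  "bip_lambda n' s t i j =
     sqrt (real (s i) * (real (s i) - 1) * real (t j) * (real (t j) - 1)) / real (\<Sum>k=1..n'. s k)"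

text \<open>
  The library's \<^const>\<open>poisson_pmf\<close> is only specified for positive rates, but the rate can be
  0 here. The distribution Po(0) is the point mass at 0.
\<close>

definition poisson0_pmf :: "real \<Rightarrow> nat pmf" where
  "poisson0_pmf r = (if r = 0 then return_pmf 0 else poisson_pmf r)"

text \<open>The joint distribution of the independent Poisson variables, indexed by pairs \<open>(i, j)\<close>.\<close>

definition indep_poissons ::
  "nat \<Rightarrow> nat \<Rightarrow> (nat \<Rightarrow> nat) \<Rightarrow> (nat \<Rightarrow> nat) \<Rightarrow> (nat \<times> nat \<Rightarrow> nat) pmf" where
  "indep_poissons n' n'' s t =
     Pi_pmf ({1..n'} \<times> {1..n''}) 0 (\<lambda>(i, j). poisson0_pmf (bip_lambda n' s t i j))"

end

theory Submission
  imports Defs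
begin

text \<open>
  Write \<open>1[X \<le> 1]\<close> as a combination \<open>\<Sum>\<^sub>l a\<^sub>l (X)\<^sub>l\<close> of falling factorials. Multiplying over all pairs \<open>(i, j)\<close>
  expresses \<open>P(Z = 0)\<close> as a sum over nonnegative integer matrices \<open>L\<close> of joint factorial moments
  \<open>\<Prod>\<^sub>i (s\<^sub>i)\<^bsub>r\<^sub>i(L)\<^esub> \<Prod>\<^sub>j (t\<^sub>j)\<^bsub>c\<^sub>j(L)\<^esub> / (N)\<^bsub>|L|\<^esub>\<close> (row sums \<open>r\<^sub>i\<close>, column sums \<open>c\<^sub>j\<close>), while the Poisson
  product is the same sum with \<open>\<Prod> \<lambda>\<^sub>i\<^sub>j ^ L\<^sub>i\<^sub>j\<close>. As \<open>a\<^sub>1 = 0\<close>, no entry of \<open>L\<close> equals 1, and both sums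
  converge absolutely, uniformly as long as \<open>\<Lambda> = \<Sum> \<lambda>\<^sub>i\<^sub>j\<^sup>2\<close> is bounded. The two terms agree up to the
  replacement of \<open>(N)\<^sub>m\<close> by \<open>N ^ m\<close> and to rows and columns of sum at least 3, whose contribution is
  of order \<open>\<Lambda> (\<surd>(t/N) + \<surd>(s/N))\<close>.

  If \<open>\<Lambda>\<close> is large, then the Poisson product is small. Splitting vertices only makes collisions rarer,
  and it can be done so that \<open>\<Lambda>\<close> becomes large but bounded, so \<open>P(Z = 0)\<close> is small as well.
\<close>

section \<open>Joint factorial moments of the edge multiplicities\<close>

primrec falling :: "nat \<Rightarrow> nat \<Rightarrow> nat" where
  "falling n 0 = 1"
| "falling n (Suc k) = n * falling (n - 1) k"

lemma falling_Suc_right: "falling n (Suc k) = falling n k * (n - k)"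
proof (induction k arbitrary: n)
  case (Suc k)
  have "falling n (Suc (Suc k)) = n * (falling (n - 1) k * (n - 1 - k))"
    by (simp only: falling.simps(2)[of n "Suc k"] Suc.IH)
  also have "\<dots> = falling n (Suc k) * (n - Suc k)" by simp
  finally show ?case .
qed simp

declare falling.simps(2) [simp del]

lemma falling_eq_binomial: "falling n k = fact k * (n choose k)"
proof (induction k arbitrary: n)
  case (Suc k)
  show ?case
  proof (cases n)
    case (Suc n')
    then show ?thesis using Suc.IH[of n'] Suc_times_binomial_eq[of n' k]
      by (simp add: falling.simps(2) algebra_simps)
  qed (simp add: falling.simps(2))
qed simp

lemma falling_fact: "k \<le> n \<Longrightarrow> falling n k * fact (n - k) = fact n"
  using binomial_fact_lemma[of k n] by (simp add: falling_eq_binomial algebra_simps)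

lemma falling_eq_0: "n < k \<Longrightarrow> falling n k = 0"
  by (simp add: falling_eq_binomial)

text \<open>The list is built from its head: after an element of colour \<open>c\<close> is chosen,
  the rest is a list over \<open>A - {h}\<close>, where the class of \<open>c\<close> has lost one
  element and all other classes are intact. This is the recursion of \<open>falling\<close>, class
  by class.\<close>

lemma card_coloured_distinct_lists:
  assumes "finite A" "finite C" "set cs \<subseteq> C"
  shows "card {hs. distinct hs \<and> set hs \<subseteq> A \<and> map p hs = cs} =
    (\<Prod>c\<in>C. falling (card {h \<in> A. p h = c}) (count_list cs c))"
  using assms(1,3)
proof (induction cs arbitrary: A)
  case Nil
  have "{hs. distinct hs \<and> set hs \<subseteq> A \<and> map p hs = []} = {[]}" by auto
  then show ?case by simp
next
  case (Cons c cs)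
  let ?S = "\<lambda>A cs. {hs. distinct hs \<and> set hs \<subseteq> A \<and> map p hs = cs}"
  let ?n = "\<lambda>A c. card {h \<in> A. p h = c}"
  have eq: "?S A (c # cs) = (\<Union>h\<in>{h \<in> A. p h = c}. (#) h ` ?S (A - {h}) cs)"
  proof (intro equalityI subsetI)
    fix hs assume "hs \<in> ?S A (c # cs)"
    then show "hs \<in> (\<Union>h\<in>{h \<in> A. p h = c}. (#) h ` ?S (A - {h}) cs)"
      by (cases hs) auto
  qed auto
  have fin: "finite (?S A' cs')" if "finite A'" for A' cs'
  proof (rule finite_subset)
    show "?S A' cs' \<subseteq> {hs. set hs \<subseteq> A' \<and> length hs = length cs'}" by auto
    show "finite {hs. set hs \<subseteq> A' \<and> length hs = length cs'}"
      using that by (rule finite_lists_length_eq)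
  qed
  have "card (?S A (c # cs)) = (\<Sum>h\<in>{h \<in> A. p h = c}. card ((#) h ` ?S (A - {h}) cs))"
    unfolding eq using Cons.prems fin by (intro card_UN_disjoint) auto
  also have "\<dots> = (\<Sum>h\<in>{h \<in> A. p h = c}. card (?S (A - {h}) cs))"
    by (intro sum.cong refl card_image) auto
  also have "\<dots> = (\<Sum>h\<in>{h \<in> A. p h = c}. \<Prod>c'\<in>C. falling (?n A c' - (if c' = c then 1 else 0)) (count_list cs c'))"
  proof (intro sum.cong refl)
    fix h assume h: "h \<in> {h \<in> A. p h = c}"
    have "?n (A - {h}) c' = ?n A c' - (if c' = c then 1 else 0)" for c'
    proof (cases "c' = c")
      case True
      have "{h' \<in> A - {h}. p h' = c'} = {h' \<in> A. p h' = c'} - {h}" by auto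
      then show ?thesis using h Cons.prems True by (simp add: card_Diff_singleton)
    next
      case False
      then have "{h' \<in> A - {h}. p h' = c'} = {h' \<in> A. p h' = c'}" using h by auto
      then show ?thesis using False by simp
    qed
    then show "card (?S (A - {h}) cs) = (\<Prod>c'\<in>C. falling (?n A c' - (if c' = c then 1 else 0)) (count_list cs c'))"
      using Cons.IH[of "A - {h}"] Cons.prems by simp
  qed
  also have "\<dots> = ?n A c * (\<Prod>c'\<in>C. falling (?n A c' - (if c' = c then 1 else 0)) (count_list cs c'))"
    by simp
  also have "\<dots> = ?n A c * (falling (?n A c - 1) (count_list cs c) * (\<Prod>c'\<in>C - {c}. falling (?n A c') (count_list cs c')))"
    using Cons.prems assms(2) by (subst prod.remove[of C c]) (auto intro!: prod.cong)
  also have "\<dots> = falling (?n A c) (count_list (c # cs) c) * (\<Prod>c'\<in>C - {c}. falling (?n A c') (count_list (c # cs) c'))"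
  proof -
    have "(\<Prod>c'\<in>C - {c}. falling (?n A c') (count_list cs c')) =
      (\<Prod>c'\<in>C - {c}. falling (?n A c') (count_list (c # cs) c'))"
      by (intro prod.cong) auto
    then show ?thesis by (simp add: falling.simps(2))
  qed
  also have "\<dots> = (\<Prod>c'\<in>C. falling (?n A c') (count_list (c # cs) c'))"
    using Cons.prems assms(2) by (intro prod.remove[symmetric]) auto
  finally show ?case .
qed

section \<open>Counting bijections with prescribed values\<close>

definition bijs :: "'a set \<Rightarrow> 'b set \<Rightarrow> ('a \<Rightarrow> 'b) set" where
  "bijs A B = {f \<in> A \<rightarrow>\<^sub>E B. bij_betw f A B}"

lemma finite_bijs: "finite A \<Longrightarrow> finite B \<Longrightarrow> finite (bijs A B)"
  unfolding bijs_def by (rule finite_subset[of _ "A \<rightarrow>\<^sub>E B"]) (auto intro: finite_PiE)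

lemma bijs_fix_eq:
  assumes "a \<in> A" "b \<in> B"
  shows "{f \<in> bijs A B. f a = b} = (\<lambda>g. g(a := b)) ` bijs (A - {a}) (B - {b})"
proof (intro equalityI subsetI)
  fix f assume f: "f \<in> {f \<in> bijs A B. f a = b}"
  have "bij_betw f (A - {a}) (B - {b})"
    using f assms bij_betw_DiffI[of f A B "{a}" "{b}"] by (auto simp: bijs_def)
  \<comment> \<open>Once \<open>a\<close> leaves the domain, extensionality requires the value
    \<open>undefined\<close> there.\<close>
  then have "bij_betw (f(a := undefined)) (A - {a}) (B - {b})"
    by (subst bij_betw_cong[of _ _ f]) auto
  moreover from this have "f(a := undefined) \<in> (A - {a}) \<rightarrow>\<^sub>E (B - {b})"
    using f by (auto simp: bijs_def PiE_def extensional_def bij_betw_def)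
  ultimately have "f(a := undefined) \<in> bijs (A - {a}) (B - {b})" by (simp add: bijs_def)
  moreover have "f = (f(a := undefined))(a := b)" using f by auto
  ultimately show "f \<in> (\<lambda>g. g(a := b)) ` bijs (A - {a}) (B - {b})" by blast
next
  fix f assume "f \<in> (\<lambda>g. g(a := b)) ` bijs (A - {a}) (B - {b})"
  then obtain g where g: "g \<in> bijs (A - {a}) (B - {b})" "f = g(a := b)" by blast
  have "bij_betw f (A - {a}) (B - {b})"
    using g by (subst bij_betw_cong[of _ _ g]) (auto simp: bijs_def)
  then have "bij_betw f (insert a (A - {a})) (insert (f a) (B - {b}))"
    using notIn_Un_bij_betw3[of a "A - {a}" f "B - {b}"] g by auto
  moreover have "insert a (A - {a}) = A" "insert b (B - {b}) = B" "f a = b" using assms g by auto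
  ultimately have b: "bij_betw f A B" by simp
  moreover from this have "f \<in> A \<rightarrow>\<^sub>E B"
    using g assms by (auto simp: bijs_def PiE_def extensional_def bij_betw_def)
  ultimately show "f \<in> {f \<in> bijs A B. f a = b}" using g by (auto simp: bijs_def)
qed

text \<open>Extensionality fixes the old value at \<open>a\<close> to \<open>undefined\<close>, so
  overwriting it loses no information.\<close>

lemma inj_on_upd_bijs: "inj_on (\<lambda>g. g(a := b)) (bijs (A - {a}) B)"
proof (rule inj_onI)
  fix g h assume "g \<in> bijs (A - {a}) B" "h \<in> bijs (A - {a}) B" and eq: "g(a := b) = h(a := b)"
  then have "g a = h a" by (auto simp: bijs_def PiE_def extensional_def)
  then show "g = h" using eq by (metis fun_upd_triv fun_upd_upd)
qed

lemma card_bijs: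
  fixes A :: "'a set" and B :: "'b set"
  assumes "finite A" "finite B" "card A = card B"
  shows "card (bijs A B) = fact (card A)"
  using assms
proof (induction A arbitrary: B rule: finite_induct)
  case empty
  then have "B = {}" by simp
  have "bijs ({} :: 'a set) B = {\<lambda>_. undefined}" unfolding \<open>B = {}\<close>
    by (auto simp: bijs_def bij_betw_def)
  then have "card (bijs ({} :: 'a set) B) = card {\<lambda>_ :: 'a. undefined :: 'b}" by (rule arg_cong)
  then show ?case by simp
next
  case (insert a A)
  have "bijs (insert a A) B = (\<Union>b\<in>B. {f \<in> bijs (insert a A) B. f a = b})"
    by (auto simp: bijs_def)
  also have "card \<dots> = (\<Sum>b\<in>B. card {f \<in> bijs (insert a A) B. f a = b})"
    using insert by (intro card_UN_disjoint) (auto simp: finite_bijs)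
  also have "\<dots> = (\<Sum>b\<in>B. fact (card A))"
  proof (intro sum.cong refl)
    fix b assume b: "b \<in> B"
    have "card {f \<in> bijs (insert a A) B. f a = b} = card (bijs (insert a A - {a}) (B - {b}))"
      using b by (simp only: bijs_fix_eq insertI1 card_image inj_on_upd_bijs)
    also have "insert a A - {a} = A" using insert by auto
    also have "card (bijs A (B - {b})) = fact (card A)"
      using insert b by (intro insert.IH) (auto simp: card_Diff_singleton)
    finally show "card {f \<in> bijs (insert a A) B. f a = b} = fact (card A)" .
  qed
  also have "\<dots> = card B * fact (card A)" by simp
  also have "card B = Suc (card A)" using insert by simp
  also have "Suc (card A) * fact (card A) = fact (card (insert a A))" using insert.hyps by simp
  finally show ?case .
qed

text \<open>Each prescribed value removes one point from either side by \<open>bijs_fix_eq\<close>,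
  until a free bijection of the remaining points is left.\<close>

lemma card_bijs_extending:
  assumes "finite A" "finite B" "card A = card B"
    and "distinct hs" "set hs \<subseteq> A" "distinct bs" "set bs \<subseteq> B" "length hs = length bs"
  shows "card {f \<in> bijs A B. map f hs = bs} = fact (card A - length hs)"
  using assms(8,1-7)
proof (induction hs bs arbitrary: A B rule: list_induct2)
  case Nil
  then show ?case by (simp add: card_bijs)
next
  case (Cons a hs b bs)
  have ab: "a \<in> A" "b \<in> B" using Cons.prems by auto
  have "{f \<in> bijs A B. map f (a # hs) = b # bs} = {f \<in> {f \<in> bijs A B. f a = b}. map f hs = bs}"
    by auto
  also have "\<dots> = (\<lambda>g. g(a := b)) ` {g \<in> bijs (A - {a}) (B - {b}). map g hs = bs}"
    using Cons.prems unfolding bijs_fix_eq[OF ab] by auto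
  also have "card \<dots> = card {g \<in> bijs (A - {a}) (B - {b}). map g hs = bs}"
    by (intro card_image inj_on_subset[OF inj_on_upd_bijs]) auto
  also have "\<dots> = fact (card (A - {a}) - length hs)"
    using Cons.prems ab by (intro Cons.IH) (auto simp: card_Diff_singleton)
  finally show ?case using Cons.prems ab by (simp add: card_Diff_singleton)
qed

text \<open>The list repeats each \<open>x\<close> exactly \<open>L x\<close> times. Stating the
  counts for an arbitrary predicate lets one list provide the entries, the row sums, the column sums
  and the total of the matrix \<open>L\<close>.\<close>

lemma ex_list_with_counts:
  assumes "finite K"
  shows "\<exists>cs. set cs \<subseteq> K \<and> (\<forall>P. length (filter P cs) = (\<Sum>x\<in>{x \<in> K. P x}. L x))"
  using assms
proof (induction K rule: finite_induct)
  case (insert x K)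
  then obtain cs where cs: "set cs \<subseteq> K" "\<And>P. length (filter P cs) = (\<Sum>x\<in>{x \<in> K. P x}. L x)"
    by blast
  have "length (filter P (replicate (L x) x @ cs)) = (\<Sum>x\<in>{y \<in> insert x K. P y}. L x)" for P
  proof (cases "P x")
    case True
    then have "{y \<in> insert x K. P y} = insert x {y \<in> K. P y}" by auto
    then show ?thesis using insert True cs(2) by (simp add: filter_replicate)
  next
    case False
    then have "{y \<in> insert x K. P y} = {y \<in> K. P y}" by auto
    then show ?thesis using False cs(2) by (simp add: filter_replicate)
  qed
  moreover have "set (replicate (L x) x @ cs) \<subseteq> insert x K" using cs(1) by auto
  ultimately show ?case by blast
qed auto

text \<open>Both sides count the pairs of a bijection and a list of distinct edges of it that
  has a prescribed list of colours.\<close>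

lemma sum_bijs_prod_falling:
  fixes p :: "'a \<Rightarrow> 'i" and q :: "'b \<Rightarrow> 'j"
  assumes A: "finite A" "finite B" "card A = card B" and IJ: "finite I" "finite J"
  shows "(\<Sum>f\<in>bijs A B. \<Prod>x\<in>I \<times> J. falling (card {h \<in> A. p h = fst x \<and> q (f h) = snd x}) (L x)) =
    (\<Prod>i\<in>I. falling (card {h \<in> A. p h = i}) (\<Sum>j\<in>J. L (i, j))) *
    (\<Prod>j\<in>J. falling (card {h \<in> B. q h = j}) (\<Sum>i\<in>I. L (i, j))) *
    fact (card A - (\<Sum>x\<in>I \<times> J. L x))"
proof -
  obtain cs where cs: "set cs \<subseteq> I \<times> J"
    "\<And>P. length (filter P cs) = (\<Sum>x\<in>{x \<in> I \<times> J. P x}. L x)"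
    using ex_list_with_counts[of "I \<times> J" L] IJ by auto
  have len: "length cs = (\<Sum>x\<in>I \<times> J. L x)"
    using cs(2)[of "\<lambda>_. True"] by simp
  have cnt: "count_list cs x = L x" if "x \<in> I \<times> J" for x
  proof -
    have "{y \<in> I \<times> J. x = y} = {x}" using that by auto
    then show ?thesis using cs(2)[of "(=) x"] by (simp add: count_list_eq_length_filter)
  qed
  have cnt1: "count_list (map fst cs) i = (\<Sum>j\<in>J. L (i, j))" if "i \<in> I" for i
  proof -
    have "count_list (map fst cs) i = (\<Sum>x\<in>{x \<in> I \<times> J. i = fst x}. L x)"
      by (simp add: count_list_eq_length_filter filter_map o_def cs(2))
    also have "{x \<in> I \<times> J. i = fst x} = Pair i ` J" using that by auto
    also have "(\<Sum>x\<in>Pair i ` J. L x) = (\<Sum>j\<in>J. L (i, j))"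
      by (subst sum.reindex) (auto simp: inj_on_def)
    finally show ?thesis .
  qed
  have cnt2: "count_list (map snd cs) j = (\<Sum>i\<in>I. L (i, j))" if "j \<in> J" for j
  proof -
    have "count_list (map snd cs) j = (\<Sum>x\<in>{x \<in> I \<times> J. j = snd x}. L x)"
      by (simp add: count_list_eq_length_filter filter_map o_def cs(2))
    also have "{x \<in> I \<times> J. j = snd x} = (\<lambda>i. (i, j)) ` I" using that by auto
    also have "(\<Sum>x\<in>(\<lambda>i. (i, j)) ` I. L x) = (\<Sum>i\<in>I. L (i, j))"
      by (subst sum.reindex) (auto simp: inj_on_def)
    finally show ?thesis .
  qed
  define H where "H = {hs. distinct hs \<and> set hs \<subseteq> A \<and> map p hs = map fst cs}"
  define H' where "H' = {bs. distinct bs \<and> set bs \<subseteq> B \<and> map q bs = map snd cs}"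
  have finH: "finite H"
  proof (rule finite_subset)
    show "H \<subseteq> {hs. set hs \<subseteq> A \<and> length hs = length cs}"
      unfolding H_def by (auto dest: map_eq_imp_length_eq)
  qed (use A in \<open>auto intro: finite_lists_length_eq\<close>)
  have finH': "finite H'"
  proof (rule finite_subset)
    show "H' \<subseteq> {hs. set hs \<subseteq> B \<and> length hs = length cs}"
      unfolding H'_def by (auto dest: map_eq_imp_length_eq)
  qed (use A in \<open>auto intro: finite_lists_length_eq\<close>)
  have map_pair: "map (\<lambda>h. (p h, r h)) hs = cs \<longleftrightarrow> map p hs = map fst cs \<and> map r hs = map snd cs"
    for hs and r :: "'a \<Rightarrow> 'j"
    by (induction hs arbitrary: cs) (auto simp: Cons_eq_map_conv map_eq_Cons_conv)
  have "(\<Sum>f\<in>bijs A B. \<Prod>x\<in>I \<times> J. falling (card {h \<in> A. p h = fst x \<and> q (f h) = snd x}) (L x)) =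
    (\<Sum>f\<in>bijs A B. card {hs. distinct hs \<and> set hs \<subseteq> A \<and> map (\<lambda>h. (p h, q (f h))) hs = cs})"
    using A IJ cs cnt
    by (subst card_coloured_distinct_lists[of _ "I \<times> J"])
       (auto intro!: sum.cong prod.cong arg_cong2[where f = falling] arg_cong[where f = card])
  \<comment> \<open>The first components of the colours do not involve \<open>f\<close>. Collecting
    that condition in \<open>H\<close> allows the two sums to be exchanged.\<close>
  also have "\<dots> = (\<Sum>f\<in>bijs A B. \<Sum>hs\<in>H. if map (q \<circ> f) hs = map snd cs then 1 else 0)"
  proof (intro sum.cong refl)
    fix f
    have "{hs. distinct hs \<and> set hs \<subseteq> A \<and> map (\<lambda>h. (p h, q (f h))) hs = cs} =
      {hs \<in> H. map (q \<circ> f) hs = map snd cs}"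
      using map_pair[of "q \<circ> f"] by (auto simp: H_def)
    then show "card {hs. distinct hs \<and> set hs \<subseteq> A \<and> map (\<lambda>h. (p h, q (f h))) hs = cs} =
      (\<Sum>hs\<in>H. if map (q \<circ> f) hs = map snd cs then 1 else 0)"
      using finH by (simp add: sum.If_cases Int_def)
  qed
  also have "\<dots> = (\<Sum>hs\<in>H. card {f \<in> bijs A B. map (q \<circ> f) hs = map snd cs})"
    using A by (subst sum.swap) (simp add: sum.If_cases finite_bijs Int_def)
  \<comment> \<open>For fixed \<open>hs\<close> the bijections are sorted by the image list
    \<open>bs\<close>, which is distinct because \<open>f\<close> is injective. Each admissible
    \<open>bs\<close> has the same number of extensions.\<close>
  also have "\<dots> = (\<Sum>hs\<in>H. card H' * fact (card A - length cs))"
  proof (intro sum.cong refl)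
    fix hs assume hs: "hs \<in> H"
    then have lhs: "length hs = length cs" by (auto simp: H_def dest: map_eq_imp_length_eq)
    have "{f \<in> bijs A B. map (q \<circ> f) hs = map snd cs} = (\<Union>bs\<in>H'. {f \<in> bijs A B. map f hs = bs})"
    proof (intro equalityI subsetI)
      fix f assume f: "f \<in> {f \<in> bijs A B. map (q \<circ> f) hs = map snd cs}"
      then have "inj_on f (set hs)" "set (map f hs) \<subseteq> B"
        using hs by (auto simp: bijs_def H_def bij_betw_def intro: inj_on_subset)
      then have "map f hs \<in> H'" using f hs by (auto simp: H_def H'_def distinct_map)
      then show "f \<in> (\<Union>bs\<in>H'. {f \<in> bijs A B. map f hs = bs})" using f by auto
    qed (auto simp: H'_def)
    also have "card \<dots> = (\<Sum>bs\<in>H'. card {f \<in> bijs A B. map f hs = bs})"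
      using A finH' by (intro card_UN_disjoint) (auto simp: finite_bijs)
    also have "\<dots> = (\<Sum>bs\<in>H'. fact (card A - length cs))"
      unfolding lhs[symmetric]
      by (intro sum.cong refl card_bijs_extending)
         (use A hs lhs in \<open>auto simp: H_def H'_def dest!: map_eq_imp_length_eq\<close>)
    finally show "card {f \<in> bijs A B. map (q \<circ> f) hs = map snd cs} = card H' * fact (card A - length cs)"
      by simp
  qed
  also have "\<dots> = card H * card H' * fact (card A - length cs)" by simp
  also have "card H = (\<Prod>i\<in>I. falling (card {h \<in> A. p h = i}) (\<Sum>j\<in>J. L (i, j)))"
    unfolding H_def using A IJ cs(1)
    by (subst card_coloured_distinct_lists[of _ I]) (auto simp: cnt1)
  also have "card H' = (\<Prod>j\<in>J. falling (card {h \<in> B. q h = j}) (\<Sum>i\<in>I. L (i, j)))"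
    unfolding H'_def using A IJ cs(1)
    by (subst card_coloured_distinct_lists[of _ J]) (auto simp: cnt2)
  finally show ?thesis unfolding len .
qed

section \<open>Expansion of the non-collision probability into factorial moments\<close>

definition acoef :: "nat \<Rightarrow> real" where
  "acoef l = (-1) ^ l * (1 - real l) / fact l"

text \<open>The factor \<open>1 - l\<close> splits the sum into the alternating sums of
  \<open>X choose l\<close> and of \<open>l * (X choose l)\<close>, both of which vanish for
  \<open>X > 1\<close>.\<close>

lemma sum_acoef_falling:
  assumes "X \<le> M"
  shows "(\<Sum>l\<le>M. acoef l * real (falling X l)) = (if X \<le> 1 then 1 else 0)"
proof -
  have "(\<Sum>l\<le>M. acoef l * real (falling X l)) = (\<Sum>l\<le>X. acoef l * real (falling X l))"
    using assms by (intro sum.mono_neutral_right) (auto simp: falling_eq_0)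
  also have "\<dots> = (\<Sum>l\<le>X. (-1) ^ l * real (X choose l)) - (\<Sum>l\<le>X. (-1) ^ l * of_nat l * real (X choose l))"
    unfolding sum_subtractf[symmetric]
    by (intro sum.cong refl) (simp add: acoef_def falling_eq_binomial field_simps)
  also have "\<dots> = (if X \<le> 1 then 1 else 0)"
  proof -
    consider "X = 0" | "X = 1" | "X > 1" by linarith
    then show ?thesis
    proof cases
      case 3
      then show ?thesis
        using choose_alternating_sum[of X, where 'a = real] choose_alternating_linear_sum[of X, where 'a = real]
        by simp
    qed auto
  qed
  finally show ?thesis .
qed

text \<open>For degree sequences of total \<open>N\<close> this is the expectation, over a uniform
  bijection, of the product of the falling factorials of the edge multiplicities. If the entries of
  \<open>L\<close> add up to more than \<open>N\<close>, some row factor is 0, so the truncated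
  subtraction does no harm.\<close>

definition fmoment :: "'i set \<Rightarrow> 'j set \<Rightarrow> ('i \<Rightarrow> nat) \<Rightarrow> ('j \<Rightarrow> nat) \<Rightarrow> nat \<Rightarrow> ('i \<times> 'j \<Rightarrow> nat) \<Rightarrow> real" where
  "fmoment I J s t N L = real (\<Prod>i\<in>I. falling (s i) (\<Sum>j\<in>J. L (i, j))) *
    real (\<Prod>j\<in>J. falling (t j) (\<Sum>i\<in>I. L (i, j))) * fact (N - sum L (I \<times> J)) / fact N"

text \<open>The fibres of the edge map are the bundles of parallel edges, so this links collisions
  with multiplicities, both in the expansion and for the multigraph.\<close>

lemma inj_on_iff_card_fibres_le:
  assumes "finite A"
  shows "inj_on k A \<longleftrightarrow> (\<forall>y. card {h \<in> A. k h = y} \<le> 1)"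
proof
  assume "inj_on k A"
  then show "\<forall>y. card {h \<in> A. k h = y} \<le> 1"
    using assms unfolding One_nat_def by (subst card_le_Suc0_iff_eq) (auto simp: inj_on_def)
next
  assume *: "\<forall>y. card {h \<in> A. k h = y} \<le> 1"
  show "inj_on k A"
  proof (rule inj_onI)
    fix g h assume "g \<in> A" "h \<in> A" "k g = k h"
    moreover have "card {h' \<in> A. k h' = k g} \<le> Suc 0" using * by simp
    ultimately show "g = h" using assms by (subst (asm) card_le_Suc0_iff_eq) auto
  qed
qed

text \<open>The colourings \<open>p\<close> and \<open>q\<close> play the role of the map from
  half-edges to vertices. Keeping them separate from the bijections means that a vertex can be split
  by changing \<open>p\<close> alone.\<close>

definition noncolliding :: "'a set \<Rightarrow> 'b set \<Rightarrow> ('a \<Rightarrow> 'i) \<Rightarrow> ('b \<Rightarrow> 'j) \<Rightarrow> ('a \<Rightarrow> 'b) set" where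
  "noncolliding A B p q = {f \<in> bijs A B. inj_on (\<lambda>h. (p h, q (f h))) A}"

text \<open>The cutoff \<open>M\<close> is any number that no multiplicity can exceed. The left side
  does not depend on it, so it can later tend to infinity.\<close>

lemma noncolliding_prob_expansion:
  fixes p :: "'a \<Rightarrow> 'i" and q :: "'b \<Rightarrow> 'j"
  assumes A: "finite A" "finite B" "card A = card B" and IJ: "finite I" "finite J"
    and col: "p ` A \<subseteq> I" "q ` B \<subseteq> J" and M: "card A \<le> M"
  shows "real (card (noncolliding A B p q)) / fact (card A) =
    (\<Sum>L\<in>(I \<times> J) \<rightarrow>\<^sub>E {..M}. (\<Prod>x\<in>I \<times> J. acoef (L x)) *
      fmoment I J (\<lambda>i. card {h \<in> A. p h = i}) (\<lambda>j. card {h \<in> B. q h = j}) (card A) L)"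
proof -
  let ?X = "\<lambda>f x. card {h \<in> A. p h = fst x \<and> q (f h) = snd x}"
  have X_le: "?X f x \<le> M" for f x
    using card_mono[of A "{h \<in> A. p h = fst x \<and> q (f h) = snd x}"] A M by auto
  have inj: "inj_on (\<lambda>h. (p h, q (f h))) A \<longleftrightarrow> (\<forall>x\<in>I \<times> J. ?X f x \<le> 1)" if f: "f \<in> bijs A B" for f
  proof -
    have fib: "{h \<in> A. (p h, q (f h)) = x} = {h \<in> A. p h = fst x \<and> q (f h) = snd x}" for x
      by (auto simp: prod_eq_iff)
    have outside: "?X f x \<le> 1" if "x \<notin> I \<times> J" for x
    proof -
      have "{h \<in> A. p h = fst x \<and> q (f h) = snd x} = {}"
        using f col that by (cases x) (fastforce simp: bijs_def)
      then show ?thesis by (simp only: card.empty zero_le_one)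
    qed
    show ?thesis
      unfolding inj_on_iff_card_fibres_le[OF A(1)] fib using outside by blast
  qed
  have "real (card (noncolliding A B p q)) = (\<Sum>f\<in>bijs A B. if inj_on (\<lambda>h. (p h, q (f h))) A then 1 else 0)"
    using A by (simp add: noncolliding_def sum.If_cases finite_bijs Int_def)
  also have "\<dots> = (\<Sum>f\<in>bijs A B. \<Prod>x\<in>I \<times> J. \<Sum>l\<le>M. acoef l * real (falling (?X f x) l))"
  proof (intro sum.cong refl)
    fix f assume f: "f \<in> bijs A B"
    have "(\<Prod>x\<in>I \<times> J. \<Sum>l\<le>M. acoef l * real (falling (?X f x) l)) = (\<Prod>x\<in>I \<times> J. if ?X f x \<le> 1 then 1 else 0)"
      using X_le by (intro prod.cong refl) (rule sum_acoef_falling)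
    also have "\<dots> = (if \<forall>x\<in>I \<times> J. ?X f x \<le> 1 then 1 else 0)"
    proof (cases "\<forall>x\<in>I \<times> J. ?X f x \<le> 1")
      case True
      then show ?thesis by (simp add: prod.neutral)
    next
      case False
      then show ?thesis using IJ by (subst prod_zero) auto
    qed
    finally show "(if inj_on (\<lambda>h. (p h, q (f h))) A then 1 else 0) =
      (\<Prod>x\<in>I \<times> J. \<Sum>l\<le>M. acoef l * real (falling (?X f x) l))"
      using inj[OF f] by simp
  qed
  also have "\<dots> = (\<Sum>f\<in>bijs A B. \<Sum>L\<in>(I \<times> J) \<rightarrow>\<^sub>E {..M}. \<Prod>x\<in>I \<times> J. acoef (L x) * real (falling (?X f x) (L x)))"
    using IJ by (subst prod_sum_PiE) auto
  also have "\<dots> = (\<Sum>L\<in>(I \<times> J) \<rightarrow>\<^sub>E {..M}. (\<Prod>x\<in>I \<times> J. acoef (L x)) *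
      real (\<Sum>f\<in>bijs A B. \<Prod>x\<in>I \<times> J. falling (?X f x) (L x)))"
    by (subst sum.swap) (simp add: prod.distrib sum_distrib_left)
  also have "\<dots> = (\<Sum>L\<in>(I \<times> J) \<rightarrow>\<^sub>E {..M}. (\<Prod>x\<in>I \<times> J. acoef (L x)) *
      fmoment I J (\<lambda>i. card {h \<in> A. p h = i}) (\<lambda>j. card {h \<in> B. q h = j}) (card A) L) * fact (card A)"
    by (simp only: sum_bijs_prod_falling[OF A IJ]) (simp add: fmoment_def sum_distrib_left sum_divide_distrib ac_simps)
  finally show ?thesis by simp
qed

section \<open>Absolutely convergent expansions\<close>

text \<open>The constant term is 1, the linear term is absent, and the remaining coefficients are
  dominated by those of \<open>x\<^sup>2 * exp x\<close>. The outer exponential makes the bound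
  multiply well over many entries.\<close>

lemma sum_abs_acoef_le:
  assumes "0 \<le> (x :: real)"
  shows "(\<Sum>l\<le>M. \<bar>acoef l\<bar> * x ^ l) \<le> exp (exp x * x\<^sup>2)"
proof -
  have coef: "\<bar>acoef (Suc (Suc k))\<bar> \<le> 1 / fact k" for k
  proof -
    have "\<bar>acoef (Suc (Suc k))\<bar> = (1 + real k) / fact (Suc (Suc k))"
      by (simp add: acoef_def abs_mult power_abs del: fact_Suc)
    also have "fact (Suc (Suc k)) = (1 + real k) * ((2 + real k) * fact k)"
      by (simp add: algebra_simps)
    also have "(1 + real k) / \<dots> = 1 / fact k * (1 / (2 + real k))"
      by (subst nonzero_divide_mult_cancel_left) auto
    also have "\<dots> \<le> 1 / fact k * 1" by (intro mult_left_mono) auto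
    finally show ?thesis by simp
  qed
  have exp_ge: "(\<Sum>k\<le>M. x ^ k / fact k) \<le> exp x"
  proof -
    have "(\<Sum>k\<le>M. x ^ k / fact k) \<le> (\<Sum>k. x ^ k / fact k)"
      using assms summable_exp[of x] by (intro sum_le_suminf) (auto simp: field_simps)
    then show ?thesis by (simp add: exp_def divide_inverse_commute)
  qed
  \<comment> \<open>Two more nonnegative terms are added so that the index can be shifted by
    two.\<close>
  have "(\<Sum>l\<le>M. \<bar>acoef l\<bar> * x ^ l) \<le> (\<Sum>l\<le>Suc (Suc M). \<bar>acoef l\<bar> * x ^ l)"
    using assms by (intro sum_mono2) auto
  also have "\<dots> \<le> 1 + (\<Sum>k\<le>M. x\<^sup>2 * (x ^ k / fact k))"
  proof (induction M)
    case 0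
    then show ?case using mult_right_mono[OF coef[of 0], of "x\<^sup>2"]
      by (simp add: acoef_def eval_nat_numeral)
  next
    case (Suc M)
    have "\<bar>acoef (Suc (Suc (Suc M)))\<bar> * x ^ Suc (Suc (Suc M)) \<le> 1 / fact (Suc M) * x ^ Suc (Suc (Suc M))"
      using assms by (intro mult_right_mono coef) auto
    also have "\<dots> = x\<^sup>2 * (x ^ Suc M / fact (Suc M))" by (simp add: power2_eq_square)
    finally show ?case using Suc
      by (subst sum.atMost_Suc, subst (2) sum.atMost_Suc) linarith
  qed
  also have "\<dots> = 1 + x\<^sup>2 * (\<Sum>k\<le>M. x ^ k / fact k)" by (simp add: sum_distrib_left)
  also have "\<dots> \<le> 1 + x\<^sup>2 * exp x" using exp_ge by (simp add: mult_left_mono)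
  also have "\<dots> \<le> exp (exp x * x\<^sup>2)" using exp_ge_add_one_self[of "exp x * x\<^sup>2"] by (simp add: mult.commute)
  finally show ?thesis .
qed

text \<open>The limit is the probability that a Poisson variable of mean \<open>x\<close> is at most
  1. The same coefficients therefore expand both models.\<close>

lemma acoef_sums: "(\<lambda>l. acoef l * x ^ l) sums ((1 + x) * exp (- x :: real))"
proof -
  have 1: "(\<lambda>l. (- x) ^ l / fact l) sums exp (- x)"
    using exp_converges[of "- x"] by (simp add: divide_inverse_commute)
  have "(\<lambda>l. real (Suc l) * (- x) ^ Suc l / fact (Suc l)) = (\<lambda>l. (- x) * ((- x) ^ l / fact l))"
  proof
    fix l
    have "real (Suc l) * (- x) ^ Suc l / fact (Suc l) = real (Suc l) * (- x) ^ Suc l / (real (Suc l) * fact l)"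
      by (simp only: fact_Suc of_nat_mult)
    also have "\<dots> = (- x) * ((- x) ^ l / fact l)" by (subst mult_divide_mult_cancel_left) auto
    finally show "real (Suc l) * (- x) ^ Suc l / fact (Suc l) = (- x) * ((- x) ^ l / fact l)" .
  qed
  then have "(\<lambda>l. real (Suc l) * (- x) ^ Suc l / fact (Suc l)) sums (- x * exp (- x))"
    using sums_mult[OF 1, of "- x"] by simp
  \<comment> \<open>The term at \<open>l = 0\<close> is 0, so the shifted series already has the
    full sum.\<close>
  then have 2: "(\<lambda>l. real l * (- x) ^ l / fact l) sums (- x * exp (- x))"
    by (subst (asm) sums_Suc_iff) simp
  have "(\<lambda>l. acoef l * x ^ l) = (\<lambda>l. (- x) ^ l / fact l - real l * (- x) ^ l / fact l)"
    by (auto simp: acoef_def power_minus[of x] divide_simps algebra_simps)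
  then show ?thesis using sums_diff[OF 1 2] by (simp add: algebra_simps)
qed

text \<open>The sum over all matrices factorises over the entries. Since each factor is 1 up to a
  quadratic term, the bound sees only the sum of squares and not the size of
  \<open>K\<close>.\<close>

lemma sum_PiE_acoef_le:
  assumes "finite K" "\<And>x. x \<in> K \<Longrightarrow> 0 \<le> y x" "\<And>x. x \<in> K \<Longrightarrow> y x \<le> (B :: real)"
  shows "(\<Sum>L\<in>K \<rightarrow>\<^sub>E {..M}. (\<Prod>x\<in>K. \<bar>acoef (L x)\<bar>) * (\<Prod>x\<in>K. y x ^ L x)) \<le> exp (exp B * (\<Sum>x\<in>K. (y x)\<^sup>2))"
proof -
  have "(\<Sum>L\<in>K \<rightarrow>\<^sub>E {..M}. (\<Prod>x\<in>K. \<bar>acoef (L x)\<bar>) * (\<Prod>x\<in>K. y x ^ L x)) =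
    (\<Prod>x\<in>K. \<Sum>l\<le>M. \<bar>acoef l\<bar> * y x ^ l)"
    using assms by (subst prod_sum_PiE) (auto simp: prod.distrib)
  also have "\<dots> \<le> (\<Prod>x\<in>K. exp (exp B * (y x)\<^sup>2))"
  proof (intro prod_mono conjI)
    fix x assume x: "x \<in> K"
    show "0 \<le> (\<Sum>l\<le>M. \<bar>acoef l\<bar> * y x ^ l)" using assms x by (intro sum_nonneg) auto
    have "(\<Sum>l\<le>M. \<bar>acoef l\<bar> * y x ^ l) \<le> exp (exp (y x) * (y x)\<^sup>2)"
      using assms x by (intro sum_abs_acoef_le) auto
    also have "\<dots> \<le> exp (exp B * (y x)\<^sup>2)" using assms x by (auto intro!: mult_right_mono)
    finally show "(\<Sum>l\<le>M. \<bar>acoef l\<bar> * y x ^ l) \<le> exp (exp B * (y x)\<^sup>2)" .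
  qed
  also have "\<dots> = exp (exp B * (\<Sum>x\<in>K. (y x)\<^sup>2))"
    using assms by (simp add: exp_sum sum_distrib_left)
  finally show ?thesis .
qed

text \<open>Rankin's trick: a factor \<open>\<theta> \<ge> 1\<close> per unit in \<open>R\<close> pays for the condition that at
  least three units lie in \<open>R\<close>; the choice \<open>\<theta> = max 1 (1 / \<rho>)\<close> keeps the sum of squares bounded.\<close>

lemma sum_PiE_acoef_ge3_le:
  fixes lam :: "'a \<Rightarrow> real"
  assumes K: "finite K" "R \<subseteq> K" and lam: "\<And>x. x \<in> K \<Longrightarrow> 0 \<le> lam x"
  defines "\<Lambda> \<equiv> \<Sum>x\<in>K. (lam x)\<^sup>2" and "\<rho> \<equiv> sqrt (\<Sum>x\<in>R. (lam x)\<^sup>2)"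
  shows "(\<Sum>L\<in>K \<rightarrow>\<^sub>E {..M}. (\<Prod>x\<in>K. \<bar>acoef (L x)\<bar>) * (\<Prod>x\<in>K. lam x ^ L x) *
      (if sum L R \<ge> 3 then 4 ^ sum L R else 0)) \<le> \<rho> ^ 3 * exp (exp (4 * (1 + sqrt \<Lambda>)) * (17 * \<Lambda> + 16))"
proof -
  have finR: "finite R" using K by (rule rev_finite_subset)
  have sq_\<rho>: "\<rho>\<^sup>2 = (\<Sum>x\<in>R. (lam x)\<^sup>2)" unfolding \<rho>_def by (simp add: sum_nonneg)
  have \<rho>0: "\<rho> \<ge> 0" unfolding \<rho>_def by (simp add: sum_nonneg)
  have \<rho>_le: "\<rho>\<^sup>2 \<le> \<Lambda>" unfolding sq_\<rho> \<Lambda>_def using K by (intro sum_mono2) auto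
  have \<Lambda>0: "\<Lambda> \<ge> 0" using \<rho>_le by (meson order_trans zero_le_power2)
  have \<rho>_sqrt: "\<rho> \<le> sqrt \<Lambda>" using \<rho>_le by (rule real_le_rsqrt)
  have lam_\<rho>: "lam x \<le> \<rho>" if "x \<in> R" for x
    unfolding \<rho>_def using finR that
    by (intro real_le_rsqrt member_le_sum[of x R "\<lambda>x. (lam x)\<^sup>2"]) auto
  have lam_\<Lambda>: "lam x \<le> sqrt \<Lambda>" if "x \<in> K" for x
    unfolding \<Lambda>_def using K(1) that
    by (intro real_le_rsqrt member_le_sum[of x K "\<lambda>x. (lam x)\<^sup>2"]) auto
  \<comment> \<open>Division by zero gives 0, so \<open>\<theta> = 1\<close> if
    \<open>\<rho> = 0\<close>.\<close>
  define \<theta> where "\<theta> = max 1 (1 / \<rho>)"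
  have \<theta>1: "\<theta> \<ge> 1" unfolding \<theta>_def by simp
  have \<theta>\<rho>: "\<theta> * \<rho> \<le> max \<rho> 1" unfolding \<theta>_def using \<rho>0 by (auto simp: max_def field_simps)
  \<comment> \<open>The factor 4 absorbs the weight \<open>4 ^ sum L R\<close>; the factor
    \<open>\<theta>\<close> pays for the restriction to at least three units in
    \<open>R\<close>.\<close>
  define y where "y x = lam x * (if x \<in> R then 4 * \<theta> else 1)" for x
  have y_le: "y x \<le> 4 * (1 + sqrt \<Lambda>)" if "x \<in> K" for x
  proof (cases "x \<in> R")
    case True
    have "y x = 4 * (\<theta> * lam x)" using True by (simp add: y_def)
    also have "\<theta> * lam x \<le> \<theta> * \<rho>" using lam_\<rho>[OF True] \<theta>1 by (intro mult_left_mono) auto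
    also have "\<dots> \<le> 1 + sqrt \<Lambda>" using \<theta>\<rho> \<rho>_sqrt \<rho>0 by linarith
    finally show ?thesis by simp
  next
    case False
    then show ?thesis using lam_\<Lambda>[OF that] lam[OF that] by (simp add: y_def)
  qed
  \<comment> \<open>The entries in \<open>R\<close> add at most
    \<open>16 * (\<theta> * \<rho>)\<^sup>2 \<le> 16 * (\<Lambda> + 1)\<close> to
    \<open>\<Lambda>\<close>.\<close>
  have y_sq: "(\<Sum>x\<in>K. (y x)\<^sup>2) \<le> 17 * \<Lambda> + 16"
  proof -
    have "(\<Sum>x\<in>K. (y x)\<^sup>2) \<le> (\<Sum>x\<in>K. (lam x)\<^sup>2 + (if x \<in> R then 16 * \<theta>\<^sup>2 * (lam x)\<^sup>2 else 0))"
      by (intro sum_mono) (auto simp: y_def power_mult_distrib algebra_simps)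
    also have "\<dots> = \<Lambda> + 16 * \<theta>\<^sup>2 * \<rho>\<^sup>2"
      unfolding sq_\<rho> \<Lambda>_def sum.distrib sum_distrib_left using K
      by (simp add: sum.If_cases Int_absorb1)
    also have "\<dots> = \<Lambda> + 16 * (\<theta> * \<rho>)\<^sup>2" by (simp add: power_mult_distrib)
    also have "(\<theta> * \<rho>)\<^sup>2 \<le> (max \<rho> 1)\<^sup>2" using \<theta>\<rho> \<theta>1 \<rho>0 by (intro power_mono) auto
    also have "(max \<rho> 1)\<^sup>2 \<le> \<Lambda> + 1" using \<rho>_le \<Lambda>0 by (auto simp: max_def)
    finally show ?thesis by simp
  qed
  have "(\<Prod>x\<in>K. lam x ^ L x) * (if sum L R \<ge> 3 then 4 ^ sum L R else 0) \<le> \<rho> ^ 3 * (\<Prod>x\<in>K. y x ^ L x)"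
    for L
  proof (cases "sum L R \<ge> 3")
    case False
    then show ?thesis using lam \<rho>0 \<theta>1 by (auto simp: y_def intro!: mult_nonneg_nonneg prod_nonneg)
  next
    case True
    have prod_y: "(\<Prod>x\<in>K. y x ^ L x) = (\<Prod>x\<in>K. lam x ^ L x) * (4 * \<theta>) ^ sum L R"
    proof -
      have "(\<Prod>x\<in>K. y x ^ L x) = (\<Prod>x\<in>K. lam x ^ L x) * (\<Prod>x\<in>K. if x \<in> R then (4 * \<theta>) ^ L x else 1)"
        unfolding prod.distrib[symmetric] by (intro prod.cong) (auto simp: y_def power_mult_distrib)
      also have "(\<Prod>x\<in>K. if x \<in> R then (4 * \<theta>) ^ L x else 1) = (4 * \<theta>) ^ sum L R"
        using K by (simp add: prod.If_cases Int_absorb1 power_sum)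
      finally show ?thesis .
    qed
    have lam_prod: "0 \<le> (\<Prod>x\<in>K. lam x ^ L x)" using lam by (auto intro!: prod_nonneg)
    show ?thesis
    \<comment> \<open>If \<open>\<rho> = 0\<close>, all rates in \<open>R\<close> are 0 and some
      entry of \<open>L\<close> there is positive, so both sides vanish.\<close>
    proof (cases "\<rho> = 0")
      case True
      obtain x where x: "x \<in> R" "L x \<noteq> 0" using \<open>sum L R \<ge> 3\<close> by (metis not_numeral_le_zero sum.neutral)
      have "lam x = 0" using lam_\<rho>[OF x(1)] lam x K True by (metis order_antisym subsetD)
      then have "(\<Prod>x\<in>K. lam x ^ L x) = 0" using x K by (intro prod_zero) (auto intro!: bexI[of _ x])
      then show ?thesis using True by simp
    next
      case False
      then have "1 \<le> \<rho> * \<theta>" using \<rho>0 unfolding \<theta>_def by (auto simp: max_def field_simps)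
      then have "1 \<le> (\<rho> * \<theta>) ^ 3" by (rule one_le_power)
      also have "\<dots> = \<rho> ^ 3 * \<theta> ^ 3" by (rule power_mult_distrib)
      also have "\<dots> \<le> \<rho> ^ 3 * \<theta> ^ sum L R"
        using \<theta>1 \<rho>0 True by (intro mult_left_mono power_increasing) auto
      finally have "(\<Prod>x\<in>K. lam x ^ L x) * 4 ^ sum L R * 1 \<le> (\<Prod>x\<in>K. lam x ^ L x) * 4 ^ sum L R * (\<rho> ^ 3 * \<theta> ^ sum L R)"
        using lam_prod by (intro mult_left_mono) auto
      then show ?thesis using True by (simp add: prod_y power_mult_distrib algebra_simps)
    qed
  qed
  then have "(\<Prod>x\<in>K. \<bar>acoef (L x)\<bar>) * (\<Prod>x\<in>K. lam x ^ L x) * (if sum L R \<ge> 3 then 4 ^ sum L R else 0)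
    \<le> \<rho> ^ 3 * ((\<Prod>x\<in>K. \<bar>acoef (L x)\<bar>) * (\<Prod>x\<in>K. y x ^ L x))" for L
    unfolding mult.assoc mult.left_commute[of "\<rho> ^ 3"]
    by (rule mult_left_mono) (simp add: prod_nonneg)
  then have "(\<Sum>L\<in>K \<rightarrow>\<^sub>E {..M}. (\<Prod>x\<in>K. \<bar>acoef (L x)\<bar>) * (\<Prod>x\<in>K. lam x ^ L x) *
      (if sum L R \<ge> 3 then 4 ^ sum L R else 0)) \<le>
     \<rho> ^ 3 * (\<Sum>L\<in>K \<rightarrow>\<^sub>E {..M}. (\<Prod>x\<in>K. \<bar>acoef (L x)\<bar>) * (\<Prod>x\<in>K. y x ^ L x))"
    unfolding sum_distrib_left by (rule sum_mono)
  also have "\<dots> \<le> \<rho> ^ 3 * exp (exp (4 * (1 + sqrt \<Lambda>)) * (\<Sum>x\<in>K. (y x)\<^sup>2))"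
    using K lam \<rho>0 \<theta>1 y_le by (intro mult_left_mono sum_PiE_acoef_le) (auto simp: y_def)
  also have "\<dots> \<le> \<rho> ^ 3 * exp (exp (4 * (1 + sqrt \<Lambda>)) * (17 * \<Lambda> + 16))"
    using y_sq \<rho>0 by (intro mult_left_mono) auto
  finally show ?thesis .
qed

section \<open>Falling factorials against powers\<close>

definition fall_base :: "nat \<Rightarrow> real" where
  "fall_base n = sqrt (real n * (real n - 1))"

lemma fall_base_arg_nonneg: "0 \<le> real n * (real n - 1)"
  by (cases n) (auto simp: algebra_simps)

lemma fall_base_nonneg: "0 \<le> fall_base n"
  unfolding fall_base_def using fall_base_arg_nonneg by simp

text \<open>By \<open>falling_2\<close> the square is exactly the second falling factorial. Hence
  rows and columns of sum 2 cause no error when falling factorials become powers of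
  \<open>fall_base\<close>.\<close>

lemma fall_base_sq: "(fall_base n)\<^sup>2 = real n * (real n - 1)"
  unfolding fall_base_def using fall_base_arg_nonneg by (rule real_sqrt_pow2)

lemma fall_base_le: "fall_base n \<le> real n"
  unfolding fall_base_def by (rule real_le_lsqrt) (auto simp: power2_eq_square algebra_simps)

lemma fall_base_ge: "real n - 1 \<le> fall_base n"
proof (cases n)
  case (Suc k)
  then show ?thesis unfolding fall_base_def
    by (intro real_le_rsqrt) (auto simp: power2_eq_square algebra_simps)
qed (simp add: fall_base_def)

lemma fall_base_le_1: "n \<le> 1 \<Longrightarrow> fall_base n = 0"
  by (cases n) (auto simp: fall_base_def)

lemma falling_2: "real (falling n 2) = real n * (real n - 1)"
  by (cases n) (auto simp: eval_nat_numeral falling.simps(2) algebra_simps)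

text \<open>Equality holds at \<open>k = 2\<close>, and every further factor \<open>n - k\<close> is
  at most \<open>n - 1 \<le> fall_base n\<close>. The exponent 1 has to be excluded because
  \<open>fall_base n < n\<close> for positive \<open>n\<close>.\<close>

lemma falling_le_fall_base:
  assumes "k \<noteq> 1"
  shows "real (falling n k) \<le> fall_base n ^ k"
proof (cases "k \<ge> 2")
  case True
  then show ?thesis
  proof (induction k rule: dec_induct)
    case base
    show ?case by (simp add: fall_base_sq falling_2)
  next
    case (step k)
    have "real (falling n (Suc k)) = real (falling n k) * real (n - k)"
      by (simp add: falling_Suc_right)
    also have "\<dots> \<le> fall_base n ^ k * fall_base n"
    proof (intro mult_mono step.IH)
      show "real (n - k) \<le> fall_base n"
        using fall_base_ge[of n] fall_base_nonneg[of n] step(1) by (cases "n \<ge> k") auto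
    qed (auto simp: fall_base_nonneg)
    finally show ?case by (simp add: mult.commute)
  qed
next
  case False
  with assms have "k = 0" by linarith
  then show ?thesis by simp
qed

lemma falling_ge_pow: "real n ^ k * (1 - (real k)\<^sup>2 / real n) \<le> real (falling n k)" if "n \<ge> 1"
proof (induction k)
  case (Suc k)
  show ?case
  proof (cases "k \<ge> n")
    case True
    have "real n \<le> real (Suc k)" using True by simp
    also have "\<dots> \<le> (real (Suc k))\<^sup>2" by (simp add: power2_eq_square)
    finally have "1 - (real (Suc k))\<^sup>2 / real n \<le> 0" using that by (simp add: field_simps)
    then have "real n ^ Suc k * (1 - (real (Suc k))\<^sup>2 / real n) \<le> 0"
      by (intro mult_nonneg_nonpos) auto
    then show ?thesis by (meson of_nat_0_le_iff order_trans)
  next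
    case False
    have "1 - (real (Suc k))\<^sup>2 / real n \<le> (1 - (real k)\<^sup>2 / real n) * (1 - real k / real n)"
    proof -
      have "(1 - (real k)\<^sup>2 / real n) * (1 - real k / real n) - (1 - (real (Suc k))\<^sup>2 / real n) =
        (real k + 1) / real n + (real k) ^ 3 / (real n)\<^sup>2"
        using that by (simp add: field_simps power2_eq_square power3_eq_cube)
      then show ?thesis using that by (smt (verit) divide_nonneg_nonneg of_nat_0_le_iff zero_le_power)
    qed
    then have "real n ^ Suc k * (1 - (real (Suc k))\<^sup>2 / real n) \<le>
      real n ^ Suc k * ((1 - (real k)\<^sup>2 / real n) * (1 - real k / real n))"
      by (intro mult_left_mono) auto
    also have "\<dots> = (real n ^ k * (1 - (real k)\<^sup>2 / real n)) * real (n - k)"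
      using that False by (simp add: field_simps)
    also have "\<dots> \<le> real (falling n k) * real (n - k)"
      by (intro mult_right_mono Suc.IH) auto
    finally show ?thesis by (simp add: falling_Suc_right)
  qed
qed simp

text \<open>This trades a polynomial loss for a geometric one, which can be absorbed into the
  rates.\<close>

lemma square_le_4_pow: "(real k)\<^sup>2 \<le> 4 ^ k"
proof -
  have "real k \<le> 2 ^ k" by (simp add: less_imp_le of_nat_less_two_power)
  then have "(real k)\<^sup>2 \<le> (2 ^ k)\<^sup>2" by (rule power_mono) simp
  also have "\<dots> = (4 :: real) ^ k" by (simp add: power2_eq_square flip: power_mult_distrib)
  finally show ?thesis .
qed

text \<open>A bound for the relative loss in replacing \<open>fall_base n ^ k\<close> by
  \<open>falling n k\<close>. It is 0 for \<open>k = 0\<close> and \<open>k = 2\<close>, where the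
  two agree, and also for \<open>n = 0\<close> by the convention on division.\<close>

definition fall_defect :: "nat \<Rightarrow> nat \<Rightarrow> real" where
  "fall_defect n k = (if k \<ge> 3 then 4 ^ k else 0) / real n"

lemma fall_defect_nonneg: "0 \<le> fall_defect n k"
  by (simp add: fall_defect_def)

lemma falling_ge_fall_base:
  assumes "k \<noteq> 1"
  shows "fall_base n ^ k * (1 - fall_defect n k) \<le> real (falling n k)"
proof (cases "k \<ge> 3 \<and> n \<ge> 1")
  case True
  show ?thesis
  proof (cases "fall_defect n k \<le> 1")
    case F: True
    have "fall_base n ^ k * (1 - fall_defect n k) \<le> real n ^ k * (1 - fall_defect n k)"
      using F by (intro mult_right_mono power_mono fall_base_le fall_base_nonneg) auto
    also have "\<dots> \<le> real n ^ k * (1 - (real k)\<^sup>2 / real n)"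
      using True square_le_4_pow[of k]
      by (intro mult_left_mono) (auto simp: fall_defect_def divide_right_mono)
    also have "\<dots> \<le> real (falling n k)" using True by (intro falling_ge_pow) auto
    finally show ?thesis .
  next
    case False
    then have "fall_base n ^ k * (1 - fall_defect n k) \<le> 0"
      by (intro mult_nonneg_nonpos) (auto simp: fall_base_nonneg)
    then show ?thesis by (meson of_nat_0_le_iff order_trans)
  qed
next
  case False
  then consider "n = 0" "k \<ge> 3" | "k = 0" | "k = 2" using assms by linarith
  then show ?thesis
  proof cases
    case 3
    then show ?thesis by (simp add: fall_defect_def fall_base_sq falling_2)
  qed (auto simp: fall_base_le_1 fall_defect_def power_0_left)
qed

text \<open>When \<open>n\<close> and \<open>k\<close> both grow by one, the old \<open>k\<close>
  factors of the power grow by at most \<open>(1 + 1 / n) ^ k \<le> exp 1 \<le> 3\<close>.\<close>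

lemma pow_le_3_pow_falling:
  assumes "k \<le> n"
  shows "real n ^ k \<le> 3 ^ k * real (falling n k)"
proof -
  \<comment> \<open>With the difference \<open>m\<close> fixed, \<open>n\<close> and
    \<open>k\<close> rise together, as in the recursion of \<open>falling\<close>.\<close>
  have "real (m + k) ^ k \<le> 3 ^ k * real (falling (m + k) k)" for m
  proof (induction k)
    case (Suc k)
    have ineq: "real (m + Suc k) ^ k \<le> 3 * real (m + k) ^ k"
    proof (cases "m + k = 0")
      case False
      have "real (m + Suc k) = real (m + k) * (1 + 1 / real (m + k))"
        using False by (simp add: divide_simps del: of_nat_add)
      then have "real (m + Suc k) ^ k = real (m + k) ^ k * (1 + 1 / real (m + k)) ^ k"
        by (simp only: power_mult_distrib)
      also have "real (m + k) ^ k * (1 + 1 / real (m + k)) ^ k \<le> real (m + k) ^ k * 3"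
      proof (rule mult_left_mono)
        have "(1 + 1 / real (m + k)) ^ k \<le> exp (1 / real (m + k)) ^ k"
          by (intro power_mono exp_ge_add_one_self) auto
        also have "\<dots> = exp (real k / real (m + k))" by (simp flip: exp_of_nat_mult)
        also have "\<dots> \<le> exp 1" using False by (simp add: divide_simps)
        also have "\<dots> \<le> 3" by (rule exp_le)
        finally show "(1 + 1 / real (m + k)) ^ k \<le> 3" .
      qed simp
      finally show ?thesis by (simp only: mult.commute)
    qed simp
    have "real (m + Suc k) ^ Suc k = real (m + Suc k) * real (m + Suc k) ^ k" by simp
    also have "\<dots> \<le> real (m + Suc k) * (3 * real (m + k) ^ k)"
      by (intro mult_left_mono ineq) auto
    also have "\<dots> \<le> real (m + Suc k) * (3 * (3 ^ k * real (falling (m + k) k)))"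
      by (intro mult_left_mono Suc.IH) auto
    also have "\<dots> = 3 ^ Suc k * real (falling (m + Suc k) (Suc k))"
      by (simp add: falling.simps(2) algebra_simps)
    finally show ?case .
  qed simp
  from this[of "n - k"] show ?thesis using assms by simp
qed

text \<open>For defects at most 1 this rests on \<open>(1 - d) * (1 - D) \<ge> 1 - (d + D)\<close>;
  otherwise the left side is not positive.\<close>

lemma prod_ge_one_minus_sum:
  fixes x y d :: "'a \<Rightarrow> real"
  assumes "finite I" "\<And>i. i \<in> I \<Longrightarrow> 0 \<le> x i" "\<And>i. i \<in> I \<Longrightarrow> 0 \<le> y i" "\<And>i. i \<in> I \<Longrightarrow> 0 \<le> d i"
    "\<And>i. i \<in> I \<Longrightarrow> x i * (1 - d i) \<le> y i"
  shows "prod x I * (1 - sum d I) \<le> prod y I"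
  using assms
proof (induction I rule: finite_induct)
  case (insert a I)
  let ?D = "sum d I"
  have IH: "prod x I * (1 - ?D) \<le> prod y I" using insert by auto
  have nn: "0 \<le> prod x I" "0 \<le> prod y I" "0 \<le> ?D" "0 \<le> d a" "0 \<le> x a" "0 \<le> y a"
    using insert by (auto intro!: prod_nonneg sum_nonneg)
  have "x a * prod x I * (1 - (d a + ?D)) \<le> y a * prod y I"
  proof (cases "d a \<le> 1 \<and> ?D \<le> 1")
    case True
    have "x a * prod x I * (1 - (d a + ?D)) \<le> x a * prod x I * ((1 - d a) * (1 - ?D))"
      using nn by (intro mult_left_mono) (auto simp: algebra_simps)
    also have "\<dots> = (x a * (1 - d a)) * (prod x I * (1 - ?D))" by simp
    also have "\<dots> \<le> y a * prod y I"
      using True nn IH insert by (intro mult_mono) auto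
    finally show ?thesis .
  next
    case False
    then have "x a * prod x I * (1 - (d a + ?D)) \<le> 0" using nn by (intro mult_nonneg_nonpos) auto
    also have "0 \<le> y a * prod y I" using nn by simp
    finally show ?thesis .
  qed
  then show ?case using insert by simp
qed simp

section \<open>Comparison with the Poisson product\<close>

text \<open>Here \<open>A\<close> bounds \<open>Lam\<close>. The first term comes from replacing
  \<open>falling N m\<close> by \<open>N ^ m\<close>; the summand with \<open>b\<close> comes from
  the rows of sum at least 3, the one with \<open>a\<close> from such columns.\<close>

definition bip_error :: "real \<Rightarrow> nat \<Rightarrow> nat \<Rightarrow> nat \<Rightarrow> real" where
  "bip_error A N a b = exp (exp (12 * sqrt A) * (144 * A)) / real N +
     A * exp (exp (4 * (1 + sqrt A)) * (17 * A + 16)) * (sqrt (real a / real N) + sqrt (real b / real N))"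

lemma sum_singleton_Times: "sum f ({i} \<times> J) = (\<Sum>j\<in>J. f (i, j))"
proof -
  have "{i} \<times> J = Pair i ` J" by auto
  then show ?thesis by (simp add: sum.reindex inj_on_def)
qed

lemma sum_Times_singleton: "sum f (I \<times> {j}) = (\<Sum>i\<in>I. f (i, j))"
proof -
  have "I \<times> {j} = (\<lambda>i. (i, j)) ` I" by auto
  then show ?thesis by (simp add: sum.reindex inj_on_def)
qed

text \<open>Of the three factors \<open>fall_base (d i)\<close>, one is cancelled by the division by
  the degree and the other two make up the sum of squares.\<close>

lemma sum_row_defect_le:
  fixes d :: "'k \<Rightarrow> nat"
  assumes "c \<ge> 0"
  shows "(\<Sum>i\<in>K. (fall_base (d i) * c) ^ 3 / real (d i)) \<le> (\<Sum>i\<in>K. (fall_base (d i))\<^sup>2) * c ^ 3"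
  unfolding sum_distrib_right
proof (rule sum_mono)
  fix i
  have "fall_base (d i) / real (d i) \<le> 1"
    using fall_base_le[of "d i"] by (cases "d i = 0") (auto simp: divide_le_eq_1)
  then have "(fall_base (d i))\<^sup>2 * c ^ 3 * (fall_base (d i) / real (d i)) \<le> (fall_base (d i))\<^sup>2 * c ^ 3 * 1"
    using assms by (intro mult_left_mono) auto
  then show "(fall_base (d i) * c) ^ 3 / real (d i) \<le> (fall_base (d i))\<^sup>2 * c ^ 3"
    by (simp add: power_mult_distrib power2_eq_square power3_eq_cube mult_ac)
qed

locale bip_degrees =
  fixes I :: "'i set" and J :: "'j set" and s :: "'i \<Rightarrow> nat" and t :: "'j \<Rightarrow> nat" and N :: nat
  assumes finite_I: "finite I" and finite_J: "finite J"
    and sum_s: "sum s I = N" and sum_t: "sum t J = N" and N_pos: "0 < N"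
begin

definition lam :: "'i \<times> 'j \<Rightarrow> real" where
  "lam x = fall_base (s (fst x)) * fall_base (t (snd x)) / real N"

definition S2 :: real where "S2 = (\<Sum>i\<in>I. (fall_base (s i))\<^sup>2)"

definition T2 :: real where "T2 = (\<Sum>j\<in>J. (fall_base (t j))\<^sup>2)"

definition Lam :: real where "Lam = (\<Sum>x\<in>I \<times> J. (lam x)\<^sup>2)"

lemma lam_nonneg: "0 \<le> lam x"
  by (simp add: lam_def fall_base_nonneg)

lemma S2_nonneg: "0 \<le> S2" and T2_nonneg: "0 \<le> T2" and Lam_nonneg: "0 \<le> Lam"
  by (simp_all add: S2_def T2_def Lam_def sum_nonneg)

text \<open>This factorisation lets \<open>Lam\<close> be tuned through one side only, which the
  splitting argument exploits.\<close>

lemma Lam_eq: "Lam = S2 * T2 / (real N)\<^sup>2"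
  unfolding Lam_def S2_def T2_def lam_def sum_product sum.cartesian_product sum_divide_distrib
  by (intro sum.cong) (auto simp: power_mult_distrib power_divide)

lemma lam_le: "x \<in> I \<times> J \<Longrightarrow> lam x \<le> sqrt Lam"
  unfolding Lam_def using finite_I finite_J
  by (intro real_le_rsqrt member_le_sum[of x _ "\<lambda>x. (lam x)\<^sup>2"]) auto

text \<open>The comparison passes through \<open>F\<close>, in which only \<open>falling N m\<close>
  has been replaced by \<open>N ^ m\<close>. From \<open>F\<close> to \<open>W\<close> the degree
  factors are replaced, each at the cost of its \<open>fall_defect\<close>.\<close>

lemma fmoment_approx:
  assumes L: "\<And>x. x \<in> I \<times> J \<Longrightarrow> L x \<noteq> 1"
  defines "W \<equiv> \<Prod>x\<in>I \<times> J. lam x ^ L x" and "m \<equiv> sum L (I \<times> J)"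
  shows "\<bar>fmoment I J s t N L - W\<bar> \<le> W * 12 ^ m / real N +
     ((\<Sum>i\<in>I. W * fall_defect (s i) (sum L ({i} \<times> J))) + (\<Sum>j\<in>J. W * fall_defect (t j) (sum L (I \<times> {j}))))"
proof -
  define X where "X = (\<Prod>i\<in>I. fall_base (s i) ^ sum L ({i} \<times> J))"
  define Y where "Y = (\<Prod>j\<in>J. fall_base (t j) ^ sum L (I \<times> {j}))"
  define S where "S = (\<Prod>i\<in>I. real (falling (s i) (sum L ({i} \<times> J))))"
  define T where "T = (\<Prod>j\<in>J. real (falling (t j) (sum L (I \<times> {j}))))"
  define D where "D = (\<Sum>i\<in>I. fall_defect (s i) (sum L ({i} \<times> J)))"
  define D' where "D' = (\<Sum>j\<in>J. fall_defect (t j) (sum L (I \<times> {j})))"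
  have row: "sum L ({i} \<times> J) = (\<Sum>j\<in>J. L (i, j))" for i
    by (rule sum_singleton_Times)
  have col: "sum L (I \<times> {j}) = (\<Sum>i\<in>I. L (i, j))" for j
    by (rule sum_Times_singleton)
  have m_row: "m = (\<Sum>i\<in>I. sum L ({i} \<times> J))"
    unfolding m_def row by (simp add: sum.cartesian_product)
  have m_col: "m = (\<Sum>j\<in>J. sum L (I \<times> {j}))"
    unfolding m_def col by (subst sum.swap) (simp add: sum.cartesian_product)
  \<comment> \<open>A sum of naturals equals 1 only if one of them does, so the bounds for exponents
    other than 1 apply to whole rows and columns.\<close>
  have row1: "sum L ({i} \<times> J) \<noteq> 1" if "i \<in> I" for i
    using L that finite_J by (subst sum_eq_1_iff) (auto simp del: One_nat_def)
  have col1: "sum L (I \<times> {j}) \<noteq> 1" if "j \<in> J" for j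
    using L that finite_I by (subst sum_eq_1_iff) (auto simp del: One_nat_def)
  have W_eq: "W = X * Y / real N ^ m"
  proof -
    have "W = (\<Prod>x\<in>I \<times> J. fall_base (s (fst x)) ^ L x) * (\<Prod>x\<in>I \<times> J. fall_base (t (snd x)) ^ L x)
      / (\<Prod>x\<in>I \<times> J. real N ^ L x)"
      unfolding W_def lam_def by (simp add: power_mult_distrib power_divide prod.distrib prod_dividef)
    also have "(\<Prod>x\<in>I \<times> J. real N ^ L x) = real N ^ m" by (simp add: m_def power_sum)
    also have "(\<Prod>x\<in>I \<times> J. fall_base (s (fst x)) ^ L x) = X"
      unfolding X_def row power_sum by (simp add: prod.cartesian_product case_prod_unfold)
    also have "(\<Prod>x\<in>I \<times> J. fall_base (t (snd x)) ^ L x) = Y"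
      unfolding Y_def col power_sum by (subst prod.swap) (simp add: prod.cartesian_product case_prod_unfold)
    finally show ?thesis .
  qed
  have nn: "0 \<le> X" "0 \<le> Y" "0 \<le> S" "0 \<le> T" "0 \<le> D" "0 \<le> D'"
    unfolding X_def Y_def S_def T_def D_def D'_def
    by (auto intro!: prod_nonneg sum_nonneg simp: fall_base_nonneg fall_defect_nonneg)
  have SX: "S \<le> X" "X * (1 - D) \<le> S"
    unfolding S_def X_def D_def using row1 finite_I
    by (auto intro!: prod_mono prod_ge_one_minus_sum falling_le_fall_base falling_ge_fall_base
        simp: fall_base_nonneg fall_defect_nonneg)
  have TY: "T \<le> Y" "Y * (1 - D') \<le> T"
    unfolding T_def Y_def D'_def using col1 finite_J
    by (auto intro!: prod_mono prod_ge_one_minus_sum falling_le_fall_base falling_ge_fall_base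
        simp: fall_base_nonneg fall_defect_nonneg)
  define F where "F = S * T / real N ^ m"
  have W0: "0 \<le> W" unfolding W_eq using nn by simp
  have FW: "F \<le> W" unfolding F_def W_eq using SX TY nn N_pos
    by (intro divide_right_mono mult_mono) auto
  have WF: "W - F \<le> W * (D + D')"
  proof -
    have "X * Y - S * T = (X - S) * Y + S * (Y - T)" by (simp add: algebra_simps)
    also have "\<dots> \<le> (X * D) * Y + X * (Y * D')"
      using SX TY nn by (intro add_mono mult_mono mult_right_mono) (auto simp: algebra_simps)
    also have "\<dots> = X * Y * (D + D')" by (simp add: algebra_simps)
    finally have "(X * Y - S * T) / real N ^ m \<le> X * Y * (D + D') / real N ^ m"
      by (intro divide_right_mono) auto
    then show ?thesis by (simp add: F_def W_eq diff_divide_distrib)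
  qed
  have fm: "fmoment I J s t N L = S * T * fact (N - m) / fact N"
    by (simp add: fmoment_def S_def T_def row col m_def)
  have "\<bar>fmoment I J s t N L - F\<bar> \<le> W * 12 ^ m / real N"
  proof (cases "m \<le> N")
    case False
    have "\<exists>i\<in>I. real (falling (s i) (sum L ({i} \<times> J))) = 0"
    proof (rule ccontr)
      assume neq: "\<not> ?thesis"
      have "m \<le> sum s I" unfolding m_row
      proof (rule sum_mono)
        fix i assume "i \<in> I"
        with neq have "falling (s i) (sum L ({i} \<times> J)) \<noteq> 0" by auto
        then show "sum L ({i} \<times> J) \<le> s i" by (metis falling_eq_0 not_le)
      qed
      with False sum_s show False by simp
    qed
    then have "S = 0" unfolding S_def using finite_I by (intro prod_zero)
    then show ?thesis using W0 by (simp add: fm F_def)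
  next
    case True
    define f where "f = real (falling N m)"
    have f_fact: "f * fact (N - m) = fact N"
      using falling_fact[OF True] unfolding f_def by (metis of_nat_fact of_nat_mult)
    have "f \<noteq> 0" using f_fact by (metis fact_nonzero mult_zero_left)
    then have f0: "f > 0" unfolding f_def by simp
    have NN: "0 < real N ^ m" using N_pos by simp
    have fm': "fmoment I J s t N L = S * T / f"
      unfolding fm f_fact[symmetric] using f0 by simp
    have f_le: "f \<le> real N ^ m"
    proof -
      have "falling n k \<le> n ^ k" for n k
      proof (induction k)
        case (Suc k)
        then show ?case unfolding falling_Suc_right power_Suc2 by (intro mult_mono) auto
      qed simp
      then show ?thesis unfolding f_def by (metis of_nat_mono of_nat_power)
    qed
    \<comment> \<open>The relative error \<open>m\<^sup>2 / N\<close> is amplified by at most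
      \<open>N ^ m / f \<le> 3 ^ m\<close>, as \<open>m\<close> may be close to \<open>N\<close>.
      With \<open>m\<^sup>2 \<le> 4 ^ m\<close> this yields the base 12.\<close>
    have "real N ^ m / f - 1 = (real N ^ m - f) / f" using f0 by (simp add: diff_divide_distrib)
    also have "\<dots> \<le> (real N ^ m * ((real m)\<^sup>2 / real N)) / f"
      using falling_ge_pow[of N m] N_pos f0 unfolding f_def
      by (intro divide_right_mono) (auto simp: algebra_simps)
    also have "\<dots> = (real N ^ m / f) * ((real m)\<^sup>2 / real N)" by simp
    also have "\<dots> \<le> 3 ^ m * (4 ^ m / real N)"
      using pow_le_3_pow_falling[OF True] f0 square_le_4_pow[of m] unfolding f_def
      by (intro mult_mono divide_right_mono) (auto simp: pos_divide_le_eq)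
    also have "\<dots> = 12 ^ m / real N" by (simp flip: power_mult_distrib)
    finally have *: "real N ^ m / f - 1 \<le> 12 ^ m / real N" .
    have "fmoment I J s t N L - F = F * (real N ^ m / f - 1)"
      unfolding fm' F_def using NN f0 by (simp add: field_simps)
    moreover have "F \<ge> 0" unfolding F_def using nn by simp
    moreover have "0 \<le> real N ^ m / f - 1" using f_le f0 by simp
    moreover have "F * (real N ^ m / f - 1) \<le> W * (12 ^ m / real N)"
      using FW * W0 \<open>0 \<le> real N ^ m / f - 1\<close> by (intro mult_mono) auto
    ultimately show ?thesis by simp
  qed
  then have "\<bar>fmoment I J s t N L - W\<bar> \<le> W * 12 ^ m / real N + W * (D + D')"
    using WF FW by linarith
  then show ?thesis by (simp add: D_def D'_def sum_distrib_left distrib_left)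
qed

lemma T2_le: "(\<And>j. j \<in> J \<Longrightarrow> t j \<le> b) \<Longrightarrow> T2 \<le> real b * real N"
  and S2_le: "(\<And>i. i \<in> I \<Longrightarrow> s i \<le> a) \<Longrightarrow> S2 \<le> real a * real N"
proof -
  have *: "(\<Sum>i\<in>K. (fall_base (d i))\<^sup>2) \<le> real c * real (sum d K)"
    if "\<And>i. i \<in> K \<Longrightarrow> d i \<le> c" for K :: "'k set" and d c
    unfolding of_nat_sum sum_distrib_left
  proof (rule sum_mono)
    fix i assume "i \<in> K"
    then have "(fall_base (d i))\<^sup>2 \<le> real (d i) * real (d i)"
      by (simp add: fall_base_sq algebra_simps)
    also have "\<dots> \<le> real c * real (d i)" using that[OF \<open>i \<in> K\<close>] by (intro mult_right_mono) auto
    finally show "(fall_base (d i))\<^sup>2 \<le> real c * real (d i)" .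
  qed
  show "(\<And>j. j \<in> J \<Longrightarrow> t j \<le> b) \<Longrightarrow> T2 \<le> real b * real N"
    using *[of J t b] by (simp add: T2_def sum_t)
  show "(\<And>i. i \<in> I \<Longrightarrow> s i \<le> a) \<Longrightarrow> S2 \<le> real a * real N"
    using *[of I s a] by (simp add: S2_def sum_s)
qed

text \<open>The error of each matrix is summed with absolute coefficients. The bounds of the
  previous section then control the three kinds of error independently of \<open>M\<close>.\<close>

lemma sum_fmoment_approx:
  assumes A: "Lam \<le> A" and a: "\<And>i. i \<in> I \<Longrightarrow> s i \<le> a" and b: "\<And>j. j \<in> J \<Longrightarrow> t j \<le> b"
  shows "\<bar>(\<Sum>L\<in>(I \<times> J) \<rightarrow>\<^sub>E {..M}. (\<Prod>x\<in>I \<times> J. acoef (L x)) * fmoment I J s t N L) -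
      (\<Prod>x\<in>I \<times> J. \<Sum>l\<le>M. acoef l * lam x ^ l)\<bar> \<le> bip_error A N a b"
proof -
  let ?K = "I \<times> J"
  let ?P = "?K \<rightarrow>\<^sub>E {..M}"
  define c where "c L = (\<Prod>x\<in>?K. \<bar>acoef (L x)\<bar>)" for L :: "'i \<times> 'j \<Rightarrow> nat"
  define W where "W L = (\<Prod>x\<in>?K. lam x ^ L x)" for L :: "'i \<times> 'j \<Rightarrow> nat"
  have finK: "finite ?K" using finite_I finite_J by simp
  have A0: "0 \<le> A" using A Lam_nonneg by simp
  have c0: "0 \<le> c L" for L unfolding c_def by (simp add: prod_nonneg)
  define E where "E = exp (exp (4 * (1 + sqrt A)) * (17 * A + 16))"
  define g where "g R L = (if sum L R \<ge> 3 then 4 ^ sum L R else (0 :: real))" for R and L :: "'i \<times> 'j \<Rightarrow> nat"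
  have termwise: "\<bar>(\<Prod>x\<in>?K. acoef (L x)) * (fmoment I J s t N L - W L)\<bar> \<le>
      c L * W L * 12 ^ sum L ?K / real N +
      ((\<Sum>i\<in>I. c L * W L * g ({i} \<times> J) L / real (s i)) + (\<Sum>j\<in>J. c L * W L * g (I \<times> {j}) L / real (t j)))"
    (is "_ \<le> ?rhs L") for L
  \<comment> \<open>Matrices with an entry 1 are outside the scope of \<open>fmoment_approx\<close>,
    but their coefficient is 0.\<close>
  proof (cases "\<exists>x\<in>?K. L x = 1")
    case True
    then have "(\<Prod>x\<in>?K. acoef (L x)) = 0" "c L = 0"
      unfolding c_def using finK by (auto intro!: prod_zero simp: acoef_def)
    then show ?thesis by simp
  next
    case False
    have "\<bar>(\<Prod>x\<in>?K. acoef (L x)) * (fmoment I J s t N L - W L)\<bar> = c L * \<bar>fmoment I J s t N L - W L\<bar>"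
      by (simp add: abs_mult abs_prod c_def)
    also have "\<dots> \<le> c L * (W L * 12 ^ sum L ?K / real N +
      ((\<Sum>i\<in>I. W L * fall_defect (s i) (sum L ({i} \<times> J))) + (\<Sum>j\<in>J. W L * fall_defect (t j) (sum L (I \<times> {j})))))"
      unfolding W_def using False by (intro mult_left_mono fmoment_approx c0) auto
    also have "\<dots> = ?rhs L"
      by (simp add: fall_defect_def g_def distrib_left sum_distrib_left mult.assoc)
    finally show ?thesis .
  qed
  \<comment> \<open>Absorbing \<open>12 ^ sum L ?K\<close> into the rates leaves a sum of the same
    type, with squares adding up to \<open>144 * Lam\<close>.\<close>
  have part1: "(\<Sum>L\<in>?P. c L * W L * 12 ^ sum L ?K / real N) \<le> exp (exp (12 * sqrt A) * (144 * A)) / real N"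
  proof -
    have "(\<Sum>L\<in>?P. c L * W L * 12 ^ sum L ?K) = (\<Sum>L\<in>?P. c L * (\<Prod>x\<in>?K. (12 * lam x) ^ L x))"
      by (intro sum.cong refl) (simp add: W_def power_mult_distrib prod.distrib power_sum)
    also have "\<dots> \<le> exp (exp (12 * sqrt A) * (\<Sum>x\<in>?K. (12 * lam x)\<^sup>2))"
      unfolding c_def using finK lam_nonneg
      by (intro sum_PiE_acoef_le)
         (auto intro!: order_trans[OF lam_le] real_sqrt_le_mono A)
    also have "(\<Sum>x\<in>?K. (12 * lam x)\<^sup>2) = 144 * Lam"
      by (simp add: Lam_def power_mult_distrib sum_distrib_left)
    finally have "(\<Sum>L\<in>?P. c L * W L * 12 ^ sum L ?K) \<le> exp (exp (12 * sqrt A) * (144 * A))"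
      using A by (smt (verit) exp_le_cancel_iff exp_ge_zero mult_left_mono)
    then show ?thesis unfolding sum_divide_distrib[symmetric] by (intro divide_right_mono) auto
  qed
  have rowcol: "(\<Sum>L\<in>?P. c L * W L * g R L) \<le> sqrt (\<Sum>x\<in>R. (lam x)\<^sup>2) ^ 3 * E" if "R \<subseteq> ?K" for R
  proof -
    have "(\<Sum>L\<in>?P. c L * W L * g R L) \<le> sqrt (\<Sum>x\<in>R. (lam x)\<^sup>2) ^ 3 *
      exp (exp (4 * (1 + sqrt Lam)) * (17 * Lam + 16))"
      unfolding c_def W_def g_def Lam_def using finK that lam_nonneg
      by (intro sum_PiE_acoef_ge3_le) auto
    also have "\<dots> \<le> sqrt (\<Sum>x\<in>R. (lam x)\<^sup>2) ^ 3 * E"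
      unfolding E_def using A Lam_nonneg
      by (intro mult_left_mono) (auto intro!: mult_mono simp: sum_nonneg)
    finally show ?thesis .
  qed
  have sqrt_over: "Lam * (sqrt Q / real N) \<le> A * sqrt (real d / real N)" if "Q \<le> real d * real N" "0 \<le> Q" for Q d
  proof -
    have "sqrt Q / real N = sqrt (Q / (real N)\<^sup>2)" by (simp add: real_sqrt_divide)
    also have "\<dots> \<le> sqrt (real d / real N)"
      using that N_pos by (intro real_sqrt_le_mono) (simp add: field_simps power2_eq_square)
    finally show ?thesis using A A0 that by (intro mult_mono) auto
  qed
  \<comment> \<open>For row \<open>i\<close> the quantity \<open>\<rho>\<close> is
    \<open>fall_base (s i) * sqrt T2 / N\<close>. Its cube over \<open>s i\<close>, summed over the
    rows, is at most \<open>Lam * sqrt T2 / N\<close>, and \<open>T2 \<le> b * N\<close>.\<close>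
  have part2: "(\<Sum>L\<in>?P. \<Sum>i\<in>I. c L * W L * g ({i} \<times> J) L / real (s i)) \<le> A * E * sqrt (real b / real N)"
  proof -
    have row_sq: "sqrt (\<Sum>x\<in>{i} \<times> J. (lam x)\<^sup>2) = fall_base (s i) * (sqrt T2 / real N)" for i
    proof -
      have "(\<Sum>x\<in>{i} \<times> J. (lam x)\<^sup>2) = (\<Sum>j\<in>J. (lam (i, j))\<^sup>2)"
        by (rule sum_singleton_Times)
      also have "\<dots> = (fall_base (s i))\<^sup>2 * T2 / (real N)\<^sup>2"
        by (simp add: lam_def T2_def power_mult_distrib power_divide sum_distrib_left sum_divide_distrib)
      finally show ?thesis by (simp add: real_sqrt_mult real_sqrt_divide fall_base_nonneg)
    qed
    have "(\<Sum>L\<in>?P. \<Sum>i\<in>I. c L * W L * g ({i} \<times> J) L / real (s i)) =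
      (\<Sum>i\<in>I. (\<Sum>L\<in>?P. c L * W L * g ({i} \<times> J) L) / real (s i))"
      by (subst sum.swap) (simp add: sum_divide_distrib)
    also have "\<dots> \<le> (\<Sum>i\<in>I. (fall_base (s i) * (sqrt T2 / real N)) ^ 3 * E / real (s i))"
      unfolding row_sq[symmetric] by (intro sum_mono divide_right_mono rowcol) auto
    also have "\<dots> = (\<Sum>i\<in>I. (fall_base (s i) * (sqrt T2 / real N)) ^ 3 / real (s i)) * E"
      by (simp add: sum_distrib_right)
    also have "\<dots> \<le> S2 * (sqrt T2 / real N) ^ 3 * E"
      unfolding S2_def using T2_nonneg
      by (intro mult_right_mono sum_row_defect_le) (auto simp: E_def)
    also have "S2 * (sqrt T2 / real N) ^ 3 = Lam * (sqrt T2 / real N)"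
      using T2_nonneg by (simp add: Lam_eq power3_eq_cube power2_eq_square)
    also have "\<dots> * E \<le> A * sqrt (real b / real N) * E"
      using T2_le[OF b] T2_nonneg by (intro mult_right_mono sqrt_over) (auto simp: E_def)
    finally show ?thesis by (simp add: mult_ac)
  qed
  have part3: "(\<Sum>L\<in>?P. \<Sum>j\<in>J. c L * W L * g (I \<times> {j}) L / real (t j)) \<le> A * E * sqrt (real a / real N)"
  proof -
    have col_sq: "sqrt (\<Sum>x\<in>I \<times> {j}. (lam x)\<^sup>2) = fall_base (t j) * (sqrt S2 / real N)" for j
    proof -
      have "(\<Sum>x\<in>I \<times> {j}. (lam x)\<^sup>2) = (\<Sum>i\<in>I. (lam (i, j))\<^sup>2)"
        by (rule sum_Times_singleton)
      also have "\<dots> = (fall_base (t j))\<^sup>2 * S2 / (real N)\<^sup>2"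
        by (simp add: lam_def S2_def power_mult_distrib power_divide sum_distrib_left sum_divide_distrib mult_ac)
      finally show ?thesis by (simp add: real_sqrt_mult real_sqrt_divide fall_base_nonneg)
    qed
    have "(\<Sum>L\<in>?P. \<Sum>j\<in>J. c L * W L * g (I \<times> {j}) L / real (t j)) =
      (\<Sum>j\<in>J. (\<Sum>L\<in>?P. c L * W L * g (I \<times> {j}) L) / real (t j))"
      by (subst sum.swap) (simp add: sum_divide_distrib)
    also have "\<dots> \<le> (\<Sum>j\<in>J. (fall_base (t j) * (sqrt S2 / real N)) ^ 3 * E / real (t j))"
      unfolding col_sq[symmetric] by (intro sum_mono divide_right_mono rowcol) auto
    also have "\<dots> = (\<Sum>j\<in>J. (fall_base (t j) * (sqrt S2 / real N)) ^ 3 / real (t j)) * E"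
      by (simp add: sum_distrib_right)
    also have "\<dots> \<le> T2 * (sqrt S2 / real N) ^ 3 * E"
      unfolding T2_def using S2_nonneg
      by (intro mult_right_mono sum_row_defect_le) (auto simp: E_def)
    also have "T2 * (sqrt S2 / real N) ^ 3 = Lam * (sqrt S2 / real N)"
      using S2_nonneg by (simp add: Lam_eq power3_eq_cube power2_eq_square)
    also have "\<dots> * E \<le> A * sqrt (real a / real N) * E"
      using S2_le[OF a] S2_nonneg by (intro mult_right_mono sqrt_over) (auto simp: E_def)
    finally show ?thesis by (simp add: mult_ac)
  qed
  have "(\<Prod>x\<in>?K. \<Sum>l\<le>M. acoef l * lam x ^ l) = (\<Sum>L\<in>?P. (\<Prod>x\<in>?K. acoef (L x)) * W L)"
    using finK by (subst prod_sum_PiE) (auto simp: W_def prod.distrib)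
  then have "\<bar>(\<Sum>L\<in>?P. (\<Prod>x\<in>?K. acoef (L x)) * fmoment I J s t N L) -
      (\<Prod>x\<in>?K. \<Sum>l\<le>M. acoef l * lam x ^ l)\<bar> =
      \<bar>\<Sum>L\<in>?P. (\<Prod>x\<in>?K. acoef (L x)) * (fmoment I J s t N L - W L)\<bar>"
    by (simp add: sum_subtractf right_diff_distrib)
  also have "\<dots> \<le> (\<Sum>L\<in>?P. ?rhs L)"
    by (intro order_trans[OF sum_abs] sum_mono termwise)
  also have "\<dots> = (\<Sum>L\<in>?P. c L * W L * 12 ^ sum L ?K / real N) +
     ((\<Sum>L\<in>?P. \<Sum>i\<in>I. c L * W L * g ({i} \<times> J) L / real (s i)) +
      (\<Sum>L\<in>?P. \<Sum>j\<in>J. c L * W L * g (I \<times> {j}) L / real (t j)))"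
    by (simp add: sum.distrib)
  also have "\<dots> \<le> bip_error A N a b"
    using part1 part2 part3 unfolding bip_error_def E_def distrib_left by linarith
  finally show ?thesis .
qed

end

section \<open>Vertex splitting\<close>

text \<open>Applying \<open>ln u \<le> u - 1\<close> to \<open>u = sqrt (1 + x)\<close> instead of
  \<open>1 + x\<close> leaves the negative square \<open>- (u - 1)\<^sup>2\<close> in the
  exponent.\<close>

lemma poisson_at_most_one_le:
  assumes "0 \<le> (x :: real)"
  shows "(1 + x) * exp (- x) \<le> exp (- (x\<^sup>2 / (4 * (1 + x))))"
proof -
  define u where "u = sqrt (1 + x)"
  have u: "1 \<le> u" "x = u\<^sup>2 - 1" using assms by (auto simp: u_def)
  have "ln (1 + x) = 2 * ln u" using assms by (simp add: u_def ln_sqrt)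
  also have "\<dots> \<le> 2 * (u - 1)" using u ln_le_minus_one[of u] by simp
  finally have "ln (1 + x) - x \<le> - ((u - 1)\<^sup>2)" using u by (simp add: power2_eq_square algebra_simps)
  moreover have "x\<^sup>2 / (4 * (1 + x)) \<le> (u - 1)\<^sup>2"
  proof -
    have "x\<^sup>2 = (u - 1)\<^sup>2 * (u + 1)\<^sup>2" unfolding u(2) by (simp add: power2_eq_square algebra_simps)
    also have "\<dots> \<le> (u - 1)\<^sup>2 * (2 * u)\<^sup>2" using u by (intro mult_left_mono power_mono) auto
    also have "\<dots> = (u - 1)\<^sup>2 * (4 * (1 + x))" using u by (simp add: power_mult_distrib)
    finally show ?thesis using assms by (simp add: pos_divide_le_eq)
  qed
  ultimately have "exp (ln (1 + x) - x) \<le> exp (- (x\<^sup>2 / (4 * (1 + x))))" by simp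
  then show ?thesis using assms by (simp add: exp_diff exp_minus divide_inverse)
qed

context bip_degrees
begin

text \<open>Since \<open>lam x \<le> sqrt Lam\<close>, the exponents share a denominator and add up
  to \<open>Lam / (4 * (1 + sqrt Lam))\<close>, which is at least \<open>sqrt Lam / 8\<close>
  because \<open>Lam \<ge> 1\<close>.\<close>

lemma poisson_product_le:
  assumes "1 \<le> A" "A \<le> Lam"
  shows "(\<Prod>x\<in>I \<times> J. (1 + lam x) * exp (- lam x)) \<le> exp (- (sqrt A / 8))"
proof -
  have Lam: "1 \<le> sqrt Lam" "sqrt A \<le> sqrt Lam" using assms by auto
  have "(\<Prod>x\<in>I \<times> J. (1 + lam x) * exp (- lam x)) \<le>
    (\<Prod>x\<in>I \<times> J. exp (- ((lam x)\<^sup>2 / (4 * (1 + sqrt Lam)))))"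
  proof (intro prod_mono conjI)
    fix x assume x: "x \<in> I \<times> J"
    show "0 \<le> (1 + lam x) * exp (- lam x)" using lam_nonneg[of x] by simp
    have "(1 + lam x) * exp (- lam x) \<le> exp (- ((lam x)\<^sup>2 / (4 * (1 + lam x))))"
      by (rule poisson_at_most_one_le[OF lam_nonneg])
    also have "\<dots> \<le> exp (- ((lam x)\<^sup>2 / (4 * (1 + sqrt Lam))))"
      using lam_le[OF x] lam_nonneg[of x] by (auto intro!: divide_left_mono mult_pos_pos)
    finally show "(1 + lam x) * exp (- lam x) \<le> exp (- ((lam x)\<^sup>2 / (4 * (1 + sqrt Lam))))" .
  qed
  also have "\<dots> = exp (- (Lam / (4 * (1 + sqrt Lam))))"
    using finite_I finite_J by (simp add: Lam_def sum_negf flip: exp_sum sum_divide_distrib)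
  also have "\<dots> \<le> exp (- (sqrt A / 8))"
  proof -
    have "sqrt A / 8 \<le> sqrt Lam / 8" using Lam by simp
    also have "\<dots> = (sqrt Lam * sqrt Lam) / (4 * (2 * sqrt Lam))"
      using Lam by (subst mult.assoc[symmetric], subst nonzero_mult_divide_mult_cancel_right) auto
    also have "\<dots> = Lam / (4 * (2 * sqrt Lam))" by (simp add: Lam_nonneg)
    also have "\<dots> \<le> Lam / (4 * (1 + sqrt Lam))" using Lam Lam_nonneg
      by (intro divide_left_mono mult_pos_pos) (auto intro: add_pos_nonneg)
    finally show ?thesis by simp
  qed
  finally show ?thesis .
qed

end

section \<open>Monochromatic pairs and refinement of colourings\<close>

definition same_colour_pairs :: "'a set \<Rightarrow> ('a \<Rightarrow> 'i) \<Rightarrow> ('a \<times> 'a) set" where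
  "same_colour_pairs A p = (SIGMA g:A. {h \<in> A. p h = p g} - {g})"

lemma finite_same_colour_pairs: "finite A \<Longrightarrow> finite (same_colour_pairs A p)"
  unfolding same_colour_pairs_def by (intro finite_SigmaI) auto

text \<open>The right side is \<open>S2\<close> for the degrees that the colouring induces, so
  \<open>S2\<close> is an integer that splitting lowers in controlled steps.\<close>

lemma card_same_colour_pairs:
  assumes "finite A" "finite I" "p ` A \<subseteq> I"
  shows "real (card (same_colour_pairs A p)) = (\<Sum>i\<in>I. (fall_base (card {h \<in> A. p h = i}))\<^sup>2)"
proof -
  let ?s = "\<lambda>i. card {h \<in> A. p h = i}"
  have "card (same_colour_pairs A p) = (\<Sum>g\<in>A. ?s (p g) - 1)"
    unfolding same_colour_pairs_def using assms by (subst card_SigmaI) (auto intro!: sum.cong)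
  also have "\<dots> = (\<Sum>i\<in>I. \<Sum>g\<in>{g \<in> A. p g = i}. ?s (p g) - 1)"
    using assms by (intro sum.group[symmetric])
  also have "\<dots> = (\<Sum>i\<in>I. ?s i * (?s i - 1))" by simp
  finally have "real (card (same_colour_pairs A p)) = (\<Sum>i\<in>I. real (?s i * (?s i - 1)))"
    by (simp only: of_nat_sum)
  also have "\<dots> = (\<Sum>i\<in>I. (fall_base (?s i))\<^sup>2)"
  proof (intro sum.cong refl)
    fix i
    show "real (?s i * (?s i - 1)) = (fall_base (?s i))\<^sup>2"
      by (cases "?s i") (auto simp: fall_base_sq algebra_simps)
  qed
  finally show ?thesis .
qed

text \<open>Giving one element of a nontrivial colour class a fresh colour keeps at least a third of
  the monochromatic pairs, so repeated splitting cannot jump over an interval of the form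
  \<open>(\<theta>, 3\<theta>]\<close>.\<close>

lemma ex_colour_refinement:
  fixes p :: "'a \<Rightarrow> nat"
  assumes "finite A" "1 \<le> \<theta>" "\<theta> < real (card (same_colour_pairs A p))"
  shows "\<exists>p' :: 'a \<Rightarrow> nat. (\<forall>g\<in>A. \<forall>h\<in>A. p' g = p' h \<longrightarrow> p g = p h) \<and>
    \<theta> < real (card (same_colour_pairs A p')) \<and> real (card (same_colour_pairs A p')) \<le> 3 * \<theta>"
  using assms(3)
proof (induction "card (same_colour_pairs A p)" arbitrary: p rule: less_induct)
  case less
  let ?n = "\<lambda>p. card (same_colour_pairs A p)"
  show ?case
  proof (cases "real (?n p) \<le> 3 * \<theta>")
    case True
    with less.prems show ?thesis by blast
  next
    case False
    then have n3: "3 \<le> ?n p" using assms(2) by linarith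
    then have "same_colour_pairs A p \<noteq> {}" by auto
    then obtain g h where gh: "g \<in> A" "h \<in> A" "p h = p g" "h \<noteq> g"
      by (auto simp: same_colour_pairs_def)
    obtain k where k: "k \<notin> p ` A"
      using ex_new_if_finite[OF infinite_UNIV_nat finite_imageI[OF assms(1)]] by blast
    define p' where "p' = p(g := k)"
    define C where "C = {h \<in> A. p h = p g}"
    have finC: "finite C" "g \<in> C" using assms(1) gh by (auto simp: C_def)
    have "card {g, h} \<le> card C" using finC gh by (intro card_mono) (auto simp: C_def)
    then have c2: "2 \<le> card C" using gh by simp
    have refines: "\<forall>x\<in>A. \<forall>y\<in>A. p' x = p' y \<longrightarrow> p x = p y"
      using k by (auto simp: p'_def)
    have "same_colour_pairs A p' \<subset> same_colour_pairs A p"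
    proof
      show "same_colour_pairs A p' \<subseteq> same_colour_pairs A p"
        using refines by (auto simp: same_colour_pairs_def)
      have "(g, h) \<in> same_colour_pairs A p" "(g, h) \<notin> same_colour_pairs A p'"
        using gh k by (auto simp: same_colour_pairs_def p'_def)
      then show "same_colour_pairs A p' \<noteq> same_colour_pairs A p" by blast
    qed
    then have lt: "?n p' < ?n p"
      using finite_same_colour_pairs[OF assms(1)] by (intro psubset_card_mono)
    \<comment> \<open>Only ordered pairs that contain \<open>g\<close> are lost, two for each other
      member of its class.\<close>
    have "same_colour_pairs A p \<subseteq> same_colour_pairs A p' \<union> ({g} \<times> (C - {g}) \<union> (C - {g}) \<times> {g})"
      by (auto simp: same_colour_pairs_def p'_def C_def)
    then have "?n p \<le> card (same_colour_pairs A p' \<union> ({g} \<times> (C - {g}) \<union> (C - {g}) \<times> {g}))"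
      using finC finite_same_colour_pairs[OF assms(1)] by (intro card_mono) auto
    also have "\<dots> \<le> ?n p' + (card ({g} \<times> (C - {g})) + card ((C - {g}) \<times> {g}))"
      by (intro order_trans[OF card_Un_le] add_left_mono card_Un_le)
    also have "\<dots> = ?n p' + 2 * (card C - 1)"
      using finC by (simp add: card_cartesian_product card_Diff_singleton)
    finally have drop: "?n p \<le> ?n p' + 2 * (card C - 1)" .
    \<comment> \<open>The loss is thus at most two thirds of the pairs. A class of size at least 3
      has enough pairs of its own; for a class of size 2 the bound \<open>n3\<close> is
      used.\<close>
    have "3 * (card C - 1) \<le> ?n p"
    proof (cases "card C = 2")
      case True
      then show ?thesis using n3 by simp
    next
      case False
      then have "3 * (card C - 1) \<le> card C * (card C - 1)" using c2 by (intro mult_right_mono) auto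
      also have "\<dots> = card (SIGMA x:C. C - {x})"
        using finC by (subst card_SigmaI) (auto simp: card_Diff_singleton)
      also have "\<dots> \<le> ?n p"
        using finite_same_colour_pairs[OF assms(1)]
        by (intro card_mono) (auto simp: same_colour_pairs_def C_def)
      finally show ?thesis .
    qed
    with drop have "?n p \<le> 3 * ?n p'" by linarith
    with False have "\<theta> < real (?n p')" by linarith
    from less.hyps[OF lt this] refines show ?thesis by blast
  qed
qed

section \<open>Estimates for arbitrary colourings\<close>

lemma noncolliding_mono:
  assumes "\<And>g h. g \<in> A \<Longrightarrow> h \<in> A \<Longrightarrow> p' g = p' h \<Longrightarrow> p g = p h"
  shows "noncolliding A B p q \<subseteq> noncolliding A B p' q"
  using assms unfolding noncolliding_def inj_on_def by blast

lemma sum_card_fibres: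
  assumes "finite A" "finite I" "p ` A \<subseteq> I"
  shows "(\<Sum>i\<in>I. card {h \<in> A. p h = i}) = card A"
  using sum.group[OF assms, of "\<lambda>_. 1 :: nat"] by simp

text \<open>For every cutoff \<open>M \<ge> card A\<close> the expansion is exact and the error
  bound is the same, while the truncated product tends to the Poisson product.\<close>

lemma noncolliding_prob_approx:
  fixes p :: "'a \<Rightarrow> 'i" and q :: "'b \<Rightarrow> 'j" and I :: "'i set" and J :: "'j set"
  assumes AB: "finite A" "finite B" "card A = card B" "0 < card A" and IJ: "finite I" "finite J"
    and col: "p ` A \<subseteq> I" "q ` B \<subseteq> J"
  defines "s \<equiv> \<lambda>i. card {h \<in> A. p h = i}" and "t \<equiv> \<lambda>j. card {h \<in> B. q h = j}"
  assumes a: "\<And>i. i \<in> I \<Longrightarrow> s i \<le> a" and b: "\<And>j. j \<in> J \<Longrightarrow> t j \<le> b"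
    and Lam: "bip_degrees.Lam I J s t (card A) \<le> K"
  shows "\<bar>real (card (noncolliding A B p q)) / fact (card A) -
      (\<Prod>x\<in>I \<times> J. (1 + bip_degrees.lam s t (card A) x) * exp (- bip_degrees.lam s t (card A) x))\<bar>
    \<le> bip_error K (card A) a b"
proof -
  interpret bip_degrees I J s t "card A"
    using AB(4) IJ sum_card_fibres[OF AB(1) IJ(1) col(1)] sum_card_fibres[OF AB(2) IJ(2) col(2)]
    unfolding s_def t_def AB(3) by unfold_locales
  have "(\<lambda>M. \<bar>real (card (noncolliding A B p q)) / fact (card A) - (\<Prod>x\<in>I \<times> J. \<Sum>l\<le>M. acoef l * lam x ^ l)\<bar>)
    \<longlonglongrightarrow> \<bar>real (card (noncolliding A B p q)) / fact (card A) - (\<Prod>x\<in>I \<times> J. (1 + lam x) * exp (- lam x))\<bar>"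
    using acoef_sums unfolding sums_def_le by (intro tendsto_intros) auto
  moreover have "\<bar>real (card (noncolliding A B p q)) / fact (card A) - (\<Prod>x\<in>I \<times> J. \<Sum>l\<le>M. acoef l * lam x ^ l)\<bar>
    \<le> bip_error K (card A) a b" if "card A \<le> M" for M
    using sum_fmoment_approx[OF Lam a b] noncolliding_prob_expansion[OF AB(1-3) IJ col that]
    unfolding s_def t_def by simp
  ultimately show ?thesis by (intro LIMSEQ_le_const2) auto
qed

lemma bip_error_nonneg: "0 \<le> K \<Longrightarrow> 0 \<le> bip_error K N a b"
  by (simp add: bip_error_def)

text \<open>If \<open>Lam\<close> exceeds \<open>3 * K\<close>, the first side is recoloured so that
  its new \<open>Lam\<close> lies between \<open>K\<close> and \<open>3 * K\<close>. The refined
  probability bounds the original one from above, and both Poisson products are at most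
  \<open>exp (- (sqrt K / 8))\<close>. Colours of that side are naturals so that fresh ones
  exist.\<close>

lemma noncolliding_prob_uniform:
  fixes p :: "'a \<Rightarrow> nat" and q :: "'b \<Rightarrow> 'j" and I :: "nat set" and J :: "'j set"
  assumes AB: "finite A" "finite B" "card A = card B" "0 < card A" and IJ: "finite I" "finite J"
    and col: "p ` A \<subseteq> I" "q ` B \<subseteq> J"
  defines "s \<equiv> \<lambda>i. card {h \<in> A. p h = i}" and "t \<equiv> \<lambda>j. card {h \<in> B. q h = j}"
  assumes a: "\<And>i. i \<in> I \<Longrightarrow> s i \<le> a" and b: "\<And>j. j \<in> J \<Longrightarrow> t j \<le> b" and K: "1 \<le> K"
  shows "\<bar>real (card (noncolliding A B p q)) / fact (card A) -
      (\<Prod>x\<in>I \<times> J. (1 + bip_degrees.lam s t (card A) x) * exp (- bip_degrees.lam s t (card A) x))\<bar>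
    \<le> bip_error (3 * K) (card A) a b + exp (- (sqrt K / 8))"
proof -
  let ?N = "card A"
  interpret bip_degrees I J s t ?N
    using AB(4) IJ sum_card_fibres[OF AB(1) IJ(1) col(1)] sum_card_fibres[OF AB(2) IJ(2) col(2)]
    unfolding s_def t_def AB(3) by unfold_locales
  let ?P = "\<Prod>x\<in>I \<times> J. (1 + lam x) * exp (- lam x)"
  show ?thesis
  proof (cases "Lam \<le> 3 * K")
    case True
    have "\<bar>real (card (noncolliding A B p q)) / fact ?N - ?P\<bar> \<le> bip_error (3 * K) ?N a b"
      using noncolliding_prob_approx[OF AB IJ col, of a b "3 * K"] a b True
      unfolding s_def t_def by blast
    then show ?thesis by (smt (verit) exp_ge_zero)
  next
    case False
    have N2: "0 < (real ?N)\<^sup>2" using AB(4) by (simp only: zero_less_power of_nat_0_less_iff)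
    have S2: "S2 = real (card (same_colour_pairs A p))"
      unfolding S2_def unfolding s_def using AB IJ col by (intro card_same_colour_pairs[symmetric]) auto
    have "T2 \<noteq> 0" using False K by (auto simp: Lam_eq)
    with T2_nonneg have T2: "0 < T2" by simp
    \<comment> \<open>Recolouring the first side leaves \<open>T2\<close> alone, so
      \<open>\<theta>\<close> is the value of \<open>S2\<close> at which \<open>Lam\<close> equals
      \<open>K\<close>.\<close>
    define \<theta> where "\<theta> = K * (real ?N)\<^sup>2 / T2"
    have "t j \<le> ?N" for j
      unfolding t_def AB(3) using AB by (intro card_mono) auto
    \<comment> \<open>\<open>ex_colour_refinement\<close> requires a threshold of at least 1;
      degrees of at most \<open>card A\<close> suffice for it.\<close>
    then have "T2 \<le> (real ?N)\<^sup>2" using T2_le[of ?N] by (simp add: power2_eq_square)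
    also have "\<dots> \<le> K * (real ?N)\<^sup>2" using K N2 by (simp add: mult_le_cancel_right1)
    finally have \<theta>1: "1 \<le> \<theta>" using T2 by (simp add: \<theta>_def)
    have "3 * \<theta> < S2" using False T2 N2 unfolding \<theta>_def Lam_eq by (simp add: field_simps)
    then have "\<theta> < real (card (same_colour_pairs A p))" using \<theta>1 S2 by linarith
    from ex_colour_refinement[OF AB(1) \<theta>1 this] obtain p' :: "'a \<Rightarrow> nat" where
      p': "\<And>g h. g \<in> A \<Longrightarrow> h \<in> A \<Longrightarrow> p' g = p' h \<Longrightarrow> p g = p h" and
      lo: "\<theta> < real (card (same_colour_pairs A p'))" and
      hi: "real (card (same_colour_pairs A p')) \<le> 3 * \<theta>" by blast
    define s' where "s' = (\<lambda>i. card {h \<in> A. p' h = i})"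
    define I' where "I' = p' ` A"
    interpret R: bip_degrees I' J s' t ?N
    proof unfold_locales
      show "finite I'" using AB by (simp add: I'_def)
      show "sum s' I' = ?N" unfolding s'_def I'_def using AB by (intro sum_card_fibres) auto
    qed (use finite_J sum_t N_pos in auto)
    have RS2: "R.S2 = real (card (same_colour_pairs A p'))"
      unfolding R.S2_def unfolding s'_def I'_def using AB by (intro card_same_colour_pairs[symmetric]) auto
    have RLam: "K \<le> R.Lam" "R.Lam \<le> 3 * K"
      using lo hi T2 N2 unfolding R.Lam_eq RS2 \<theta>_def
      by (simp_all add: pos_le_divide_eq pos_divide_le_eq pos_divide_less_eq)
    have s'_le: "s' i \<le> a" if "i \<in> I'" for i
    proof -
      from that obtain h where h: "h \<in> A" "i = p' h" by (auto simp: I'_def)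
      have "{g \<in> A. p' g = i} \<subseteq> {g \<in> A. p g = p h}" using p' h by blast
      then have "s' i \<le> s (p h)" unfolding s'_def s_def using AB(1) by (intro card_mono) simp_all
      also have "\<dots> \<le> a" by (rule a) (use h(1) col(1) in blast)
      finally show ?thesis .
    qed
    let ?P' = "\<Prod>x\<in>I' \<times> J. (1 + R.lam x) * exp (- R.lam x)"
    have "\<bar>real (card (noncolliding A B p' q)) / fact ?N - ?P'\<bar> \<le> bip_error (3 * K) ?N a b"
      using noncolliding_prob_approx[OF AB _ IJ(2) _ col(2), of I' p' a b "3 * K"] s'_le b RLam AB
      unfolding s'_def t_def I'_def by blast
    moreover have "?P' \<le> exp (- (sqrt K / 8))" by (rule R.poisson_product_le[OF K RLam(1)])
    moreover have "?P \<le> exp (- (sqrt K / 8))" using False K by (intro poisson_product_le) auto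
    moreover have "real (card (noncolliding A B p q)) / fact ?N \<le> real (card (noncolliding A B p' q)) / fact ?N"
    proof (intro divide_right_mono of_nat_mono card_mono)
      show "noncolliding A B p q \<subseteq> noncolliding A B p' q" using p' by (rule noncolliding_mono)
      show "finite (noncolliding A B p' q)" using AB by (simp add: noncolliding_def finite_bijs)
    qed simp
    moreover have "0 \<le> real (card (noncolliding A B p q)) / fact ?N" by simp
    moreover have "0 \<le> ?P" by (intro prod_nonneg) (simp add: lam_nonneg)
    moreover have "0 \<le> bip_error (3 * K) ?N a b" using K by (intro bip_error_nonneg) auto
    \<comment> \<open>Both quantities are nonnegative and at most the right side, hence so is their
      distance.\<close>
    ultimately show ?thesis by linarith
  qed
qed

lemma bip_error_tendsto_0:
  fixes N a b :: "nat \<Rightarrow> nat"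
  assumes N: "filterlim N at_top sequentially"
    and a: "(\<lambda>m. real (a m)) \<in> o(\<lambda>m. real (N m))" and b: "(\<lambda>m. real (b m)) \<in> o(\<lambda>m. real (N m))"
  shows "(\<lambda>m. bip_error K (N m) (a m) (b m)) \<longlonglongrightarrow> 0"
proof -
  have "filterlim (\<lambda>m. real (N m)) at_infinity sequentially"
    by (intro filterlim_at_top_imp_at_infinity filterlim_compose[OF filterlim_real_sequentially N])
  then have "(\<lambda>m. exp (exp (12 * sqrt K) * (144 * K)) / real (N m)) \<longlonglongrightarrow> 0"
    by (rule tendsto_divide_0[OF tendsto_const])
  moreover have "(\<lambda>m. sqrt (real (a m) / real (N m))) \<longlonglongrightarrow> sqrt 0"
    by (rule tendsto_real_sqrt[OF smalloD_tendsto[OF a]])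
  moreover have "(\<lambda>m. sqrt (real (b m) / real (N m))) \<longlonglongrightarrow> sqrt 0"
    by (rule tendsto_real_sqrt[OF smalloD_tendsto[OF b]])
  ultimately have "(\<lambda>m. bip_error K (N m) (a m) (b m)) \<longlonglongrightarrow>
    0 + K * exp (exp (4 * (1 + sqrt K)) * (17 * K + 16)) * (sqrt 0 + sqrt 0)"
    unfolding bip_error_def by (intro tendsto_add tendsto_mult_left)
  then show ?thesis by simp
qed

section \<open>The configuration model\<close>

lemma matchings_eq_bijs: "matchings n' n'' s t = bijs (half_edges n' s) (half_edges n'' t)"
  by (simp add: matchings_def bijs_def)

lemma finite_half_edges: "finite (half_edges n d)"
  by (simp add: half_edges_def)

lemma card_half_edges: "card (half_edges n d) = (\<Sum>i=1..n. d i)"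
  by (simp add: half_edges_def)

lemma card_half_edges_at: "i \<in> {1..n} \<Longrightarrow> card {h \<in> half_edges n d. fst h = i} = d i"
proof -
  assume "i \<in> {1..n}"
  then have "{h \<in> half_edges n d. fst h = i} = {i} \<times> {1..d i}" by (auto simp: half_edges_def)
  then show ?thesis by (simp add: card_cartesian_product)
qed

lemma count_matching_graph:
  "count (matching_graph n' s f) e = card {h \<in> half_edges n' s. {Inl (fst h), Inr (fst (f h))} = e}"
  by (simp add: matching_graph_def count_image_mset' finite_half_edges eq_commute Int_def conj_commute)

lemma inj_on_edges_iff:
  "inj_on (\<lambda>h. {Inl (fst h), Inr (fst (f h))}) A \<longleftrightarrow> inj_on (\<lambda>h. (fst h, fst (f h))) A"
  by (simp add: inj_on_def doubleton_eq_iff)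

text \<open>The tags \<open>Inl\<close> and \<open>Inr\<close> rule out loops, so simplicity is a
  matter of multiplicities only.\<close>

lemma simple_matching_graph_iff:
  "simple_multigraph (matching_graph n' s f) \<longleftrightarrow> inj_on (\<lambda>h. (fst h, fst (f h))) (half_edges n' s)"
proof -
  let ?G = "matching_graph n' s f"
  have card2: "card e = 2" if "e \<in># ?G" for e
    using that by (auto simp: matching_graph_def)
  have "simple_multigraph ?G \<longleftrightarrow> (\<forall>e. e \<in># ?G \<longrightarrow> count ?G e = 1)"
    using card2 by (auto simp: simple_multigraph_def)
  also have "\<dots> \<longleftrightarrow> (\<forall>e. count ?G e \<le> 1)"
  proof (intro iff_allI)
    fix e
    show "(e \<in># ?G \<longrightarrow> count ?G e = 1) \<longleftrightarrow> count ?G e \<le> 1"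
      by (cases "count ?G e") (auto simp flip: count_greater_zero_iff)
  qed
  also have "\<dots> \<longleftrightarrow> inj_on (\<lambda>h. (fst h, fst (f h))) (half_edges n' s)"
    unfolding count_matching_graph inj_on_edges_iff[symmetric]
    by (rule inj_on_iff_card_fibres_le[OF finite_half_edges, symmetric])
  finally show ?thesis .
qed

lemma pair_count_eq_0_iff:
  "pair_count n' n'' x = 0 \<longleftrightarrow> (\<forall>i\<in>{1..n'}. \<forall>j\<in>{1..n''}. x i j \<le> 1)"
  unfolding pair_count_def by (simp add: binomial_eq_0_iff numeral_2_eq_2 less_Suc_eq_le)

lemma pair_count_matching_graph_eq_0_iff:
  assumes "f \<in> matchings n' n'' s t"
  shows "pair_count n' n'' (edge_mult (matching_graph n' s f)) = 0 \<longleftrightarrow>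
    inj_on (\<lambda>h. (fst h, fst (f h))) (half_edges n' s)"
proof -
  let ?H = "half_edges n' s"
  have edge: "{Inl (fst h), Inr (fst (f h))} = {Inl i, Inr j} \<longleftrightarrow> (fst h, fst (f h)) = (i, j)" for h i j
    by (auto simp: doubleton_eq_iff)
  have fib: "{h \<in> ?H. (fst h, fst (f h)) = y} = {}" if "y \<notin> {1..n'} \<times> {1..n''}" for y
    using assms that by (fastforce simp: matchings_def half_edges_def PiE_def Pi_def)
  have "pair_count n' n'' (edge_mult (matching_graph n' s f)) = 0 \<longleftrightarrow>
    (\<forall>y\<in>{1..n'} \<times> {1..n''}. card {h \<in> ?H. (fst h, fst (f h)) = y} \<le> 1)"
    by (simp add: pair_count_eq_0_iff edge_mult_def count_matching_graph edge)
  also have "\<dots> \<longleftrightarrow> (\<forall>y. card {h \<in> ?H. (fst h, fst (f h)) = y} \<le> 1)"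
  proof (intro iffI allI)
    fix y assume *: "\<forall>y\<in>{1..n'} \<times> {1..n''}. card {h \<in> ?H. (fst h, fst (f h)) = y} \<le> 1"
    show "card {h \<in> ?H. (fst h, fst (f h)) = y} \<le> 1"
    proof (cases "y \<in> {1..n'} \<times> {1..n''}")
      case True
      with * show ?thesis by (rule bspec)
    next
      case False
      show ?thesis unfolding fib[OF False] by simp
    qed
  qed blast
  also have "\<dots> \<longleftrightarrow> inj_on (\<lambda>h. (fst h, fst (f h))) ?H"
    by (rule inj_on_iff_card_fibres_le[OF finite_half_edges, symmetric])
  finally show ?thesis .
qed

text \<open>A general event \<open>P\<close> lets simplicity and \<open>Z = 0\<close> be reduced to
  the same count.\<close>

lemma prob_bip_config_model:
  assumes "(\<Sum>i=1..n'. s i) = (\<Sum>j=1..n''. t j)"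
    and "\<And>f. f \<in> matchings n' n'' s t \<Longrightarrow>
      P (matching_graph n' s f) \<longleftrightarrow> inj_on (\<lambda>h. (fst h, fst (f h))) (half_edges n' s)"
  shows "measure_pmf.prob (bip_config_model n' n'' s t) {G. P G} =
    real (card (noncolliding (half_edges n' s) (half_edges n'' t) fst fst)) / fact (\<Sum>i=1..n'. s i)"
proof -
  let ?M = "matchings n' n'' s t"
  have fin: "finite ?M" unfolding matchings_eq_bijs by (intro finite_bijs finite_half_edges)
  have card: "card ?M = fact (\<Sum>i=1..n'. s i)"
    unfolding matchings_eq_bijs using assms(1)
    by (subst card_bijs) (simp_all add: finite_half_edges card_half_edges)
  then have "?M \<noteq> {}" by auto
  then have "measure_pmf.prob (bip_config_model n' n'' s t) {G. P G} =
    real (card (?M \<inter> matching_graph n' s -` {G. P G})) / real (card ?M)"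
    using fin by (simp add: bip_config_model_def measure_pmf_of_set)
  also have "?M \<inter> matching_graph n' s -` {G. P G} = noncolliding (half_edges n' s) (half_edges n'' t) fst fst"
    using assms(2) unfolding noncolliding_def matchings_eq_bijs by auto
  finally show ?thesis by (simp add: card)
qed

lemma bip_lambda_nonneg: "0 \<le> bip_lambda n' s t i j"
proof -
  have "0 \<le> (real (s i) * (real (s i) - 1)) * (real (t j) * (real (t j) - 1))"
    by (intro mult_nonneg_nonneg[OF fall_base_arg_nonneg fall_base_arg_nonneg])
  then show ?thesis by (simp add: bip_lambda_def mult.assoc sum_nonneg)
qed

lemma prob_poisson0_le_1: "0 \<le> r \<Longrightarrow> measure_pmf.prob (poisson0_pmf r) {..1} = (1 + r) * exp (- r)"
proof -
  assume r: "0 \<le> r"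
  have eq: "{..1 :: nat} = {0, 1}" by auto
  show ?thesis
  proof (cases "r = 0")
    case True
    then show ?thesis by (simp add: poisson0_pmf_def)
  next
    case False
    with r show ?thesis
      by (simp add: poisson0_pmf_def eq measure_measure_pmf_finite algebra_simps)
  qed
qed

text \<open>The event is a box that restricts each coordinate to \<open>{..1}\<close>, so
  independence turns its probability into a product.\<close>

lemma prob_indep_poissons:
  "measure_pmf.prob (indep_poissons n' n'' s t) {x. pair_count n' n'' (\<lambda>i j. x (i, j)) = 0} =
    (\<Prod>x\<in>{1..n'} \<times> {1..n''}. (1 + bip_lambda n' s t (fst x) (snd x)) * exp (- bip_lambda n' s t (fst x) (snd x)))"
proof -
  have "{x. pair_count n' n'' (\<lambda>i j. x (i, j)) = 0} = Pi ({1..n'} \<times> {1..n''}) (\<lambda>_. {..1 :: nat})"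
    by (auto simp: pair_count_eq_0_iff Pi_def)
  then show ?thesis
    unfolding indep_poissons_def
    by (simp add: measure_Pi_pmf_Pi case_prod_unfold prob_poisson0_le_1[unfolded One_nat_def] bip_lambda_nonneg)
qed

theorem theorem5p3:
  fixes n' n'' :: "nat \<Rightarrow> nat" and s t :: "nat \<Rightarrow> nat \<Rightarrow> nat" and N :: "nat \<Rightarrow> nat"
  assumes "\<And>m. N m = (\<Sum>i=1..n' m. s m i)"
    and "\<And>m. N m = (\<Sum>j=1..n'' m. t m j)"
    and "filterlim N at_top sequentially"
    and "(\<lambda>m. real (Max (s m ` {1..n' m}))) \<in> o(\<lambda>m. real (N m))"
    and "(\<lambda>m. real (Max (t m ` {1..n'' m}))) \<in> o(\<lambda>m. real (N m))"
  defines "p_simple \<equiv> \<lambda>m. measure_pmf.prob (bip_config_model (n' m) (n'' m) (s m) (t m))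
             {G. simple_multigraph G}"
    and "p_Z \<equiv> \<lambda>m. measure_pmf.prob (bip_config_model (n' m) (n'' m) (s m) (t m))
             {G. pair_count (n' m) (n'' m) (edge_mult G) = 0}"
    and "p_Zhat \<equiv> \<lambda>m. measure_pmf.prob (indep_poissons (n' m) (n'' m) (s m) (t m))
             {x. pair_count (n' m) (n'' m) (\<lambda>i j. x (i, j)) = 0}"
    and "limit_expr \<equiv> \<lambda>m. exp (- (\<Sum>i=1..n' m. \<Sum>j=1..n'' m.
             bip_lambda (n' m) (s m) (t m) i j - ln (1 + bip_lambda (n' m) (s m) (t m) i j)))"
  shows "(\<forall>m. p_simple m = p_Z m)
       \<and> (\<lambda>m. p_Z m - p_Zhat m) \<in> o(\<lambda>_. 1)
       \<and> (\<lambda>m. p_Z m - limit_expr m) \<in> o(\<lambda>_. 1)"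
proof -
  let ?A = "\<lambda>m. half_edges (n' m) (s m)" and ?B = "\<lambda>m. half_edges (n'' m) (t m)"
  let ?lam = "\<lambda>m x. bip_lambda (n' m) (s m) (t m) (fst x) (snd x)"
  let ?a = "\<lambda>m. Max (s m ` {1..n' m})" and ?b = "\<lambda>m. Max (t m ` {1..n'' m})"
  have sum_eq: "(\<Sum>i=1..n' m. s m i) = (\<Sum>j=1..n'' m. t m j)" for m
    using assms(1,2) by metis
  have p_Z: "p_Z m = real (card (noncolliding (?A m) (?B m) fst fst)) / fact (N m)" for m
    unfolding p_Z_def assms(1) by (intro prob_bip_config_model sum_eq pair_count_matching_graph_eq_0_iff)
  have p_simple: "p_simple m = p_Z m" for m
    unfolding p_Z unfolding p_simple_def assms(1)
    by (intro prob_bip_config_model sum_eq simple_matching_graph_iff)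
  have p_Zhat: "p_Zhat m = (\<Prod>x\<in>{1..n' m} \<times> {1..n'' m}. (1 + ?lam m x) * exp (- ?lam m x))" for m
    unfolding p_Zhat_def by (rule prob_indep_poissons)
  have limit_expr: "limit_expr m = p_Zhat m" for m
  proof -
    have "limit_expr m = exp (\<Sum>x\<in>{1..n' m} \<times> {1..n'' m}. ln (1 + ?lam m x) - ?lam m x)"
      unfolding limit_expr_def
      by (simp add: sum.cartesian_product case_prod_unfold flip: sum_negf)
    also have "\<dots> = (\<Prod>x\<in>{1..n' m} \<times> {1..n'' m}. exp (ln (1 + ?lam m x) - ?lam m x))"
      by (simp add: exp_sum)
    also have "\<dots> = p_Zhat m"
      unfolding p_Zhat
    proof (intro prod.cong refl)
      fix x
      show "exp (ln (1 + ?lam m x) - ?lam m x) = (1 + ?lam m x) * exp (- ?lam m x)"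
        using bip_lambda_nonneg[of "n' m" "s m" "t m" "fst x" "snd x"]
        by (simp add: exp_diff exp_minus divide_inverse)
    qed
    finally show ?thesis .
  qed
  \<comment> \<open>\<open>K\<close> is still free here; it is fixed according to the desired
    accuracy before \<open>m\<close> grows.\<close>
  have approx: "\<bar>p_Z m - p_Zhat m\<bar> \<le> bip_error (3 * K) (N m) (?a m) (?b m) + exp (- (sqrt K / 8))"
    if "1 \<le> K" "0 < N m" for K m
  proof -
    have cards: "card (?A m) = N m" "card (?B m) = N m"
      using assms(1,2) by (simp_all add: card_half_edges)
    have *: "\<bar>real (card (noncolliding (?A m) (?B m) fst fst)) / fact (card (?A m)) -
      (\<Prod>x\<in>{1..n' m} \<times> {1..n'' m}.
         (1 + bip_degrees.lam (\<lambda>i. card {h \<in> ?A m. fst h = i}) (\<lambda>j. card {h \<in> ?B m. fst h = j}) (card (?A m)) x) *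
         exp (- bip_degrees.lam (\<lambda>i. card {h \<in> ?A m. fst h = i}) (\<lambda>j. card {h \<in> ?B m. fst h = j}) (card (?A m)) x))\<bar>
      \<le> bip_error (3 * K) (card (?A m)) (?a m) (?b m) + exp (- (sqrt K / 8))"
    proof (rule noncolliding_prob_uniform)
      show "fst ` ?A m \<subseteq> {1..n' m}" "fst ` ?B m \<subseteq> {1..n'' m}" by (auto simp: half_edges_def)
      show "card {h \<in> ?A m. fst h = i} \<le> ?a m" if "i \<in> {1..n' m}" for i
        unfolding card_half_edges_at[OF that] using that by (intro Max_ge) auto
      show "card {h \<in> ?B m. fst h = j} \<le> ?b m" if "j \<in> {1..n'' m}" for j
        unfolding card_half_edges_at[OF that] using that by (intro Max_ge) auto
    qed (use that cards finite_half_edges in simp_all)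
    have "bip_degrees.lam (\<lambda>i. card {h \<in> ?A m. fst h = i}) (\<lambda>j. card {h \<in> ?B m. fst h = j}) (N m) x = ?lam m x"
      if x_in: "x \<in> {1..n' m} \<times> {1..n'' m}" for x
    proof -
      interpret bip_degrees "{1..n' m}" "{1..n'' m}" "\<lambda>i. card {h \<in> ?A m. fst h = i}"
        "\<lambda>j. card {h \<in> ?B m. fst h = j}" "N m"
        using \<open>0 < N m\<close> assms(1,2) by unfold_locales (simp_all add: card_half_edges_at del: atLeastAtMost_iff)
      obtain i j where x: "x = (i, j)" "i \<in> {1..n' m}" "j \<in> {1..n'' m}" using x_in by blast
      have "lam x = fall_base (s m i) * fall_base (t m j) / real (N m)"
        unfolding lam_def x(1) fst_conv snd_conv card_half_edges_at[OF x(2)] card_half_edges_at[OF x(3)] ..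
      also have "\<dots> = ?lam m x"
        unfolding x(1) assms(1) by (simp add: bip_lambda_def fall_base_def mult.assoc flip: real_sqrt_mult)
      finally show ?thesis .
    qed
    with * show ?thesis unfolding cards p_Z p_Zhat by (simp cong: prod.cong)
  qed
  have "(\<lambda>m. p_Z m - p_Zhat m) \<longlonglongrightarrow> 0"
  proof (rule LIMSEQ_I)
    fix e :: real assume e: "0 < e"
    \<comment> \<open>The second argument exceeds \<open>- 8 * ln (e / 2)\<close>, which makes the
      exponential smaller than \<open>e / 2\<close>; the first ensures
      \<open>K \<ge> 1\<close>.\<close>
    define y where "y = max 1 (1 - 8 * ln (e / 2))"
    define K where "K = y\<^sup>2"
    have y: "1 \<le> y" "sqrt K = y" by (auto simp: y_def K_def)
    have "exp (- (sqrt K / 8)) < exp (ln (e / 2))"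
      unfolding y(2) exp_less_cancel_iff by (simp add: y_def max_def field_simps)
    then have small: "exp (- (sqrt K / 8)) < e / 2" using e by simp
    have "eventually (\<lambda>m. bip_error (3 * K) (N m) (?a m) (?b m) < e / 2) sequentially"
      using e by (intro order_tendstoD(2)[OF bip_error_tendsto_0[OF assms(3-5)]]) auto
    moreover have "eventually (\<lambda>m. 0 < N m) sequentially"
      by (rule eventually_compose_filterlim[OF eventually_gt_at_top assms(3)])
    ultimately have "eventually (\<lambda>m. norm (p_Z m - p_Zhat m - 0) < e) sequentially"
    proof eventually_elim
      case (elim m)
      have "1 \<le> K" using y(1) by (simp add: K_def)
      from approx[OF this elim(2)] elim small show ?case by simp
    qed
    then show "\<exists>no. \<forall>m\<ge>no. norm (p_Z m - p_Zhat m - 0) < e"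
      by (simp add: eventually_sequentially)
  qed
  then have "(\<lambda>m. p_Z m - p_Zhat m) \<in> o(\<lambda>_. 1)"
    by (intro smalloI_tendsto) auto
  then show ?thesis using p_simple limit_expr by simp
qed

end
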